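(* Let $(M,\mathcal{T},\Phi)$ be a weighted triangulated closed connected surface with $\chi(M)\le -1$ and a branch structure with orders $\beta=(\beta_1,\dots,\beta_N)^T$, and let $\alpha\ge0$. The branched $\alpha$-potential in $\mathbb{H}^2$, $$F^{\mathbb{H}}(u^{\mathbb{H}})=\int_{u_*^{\mathbb{H}}}^{u^{\mathbb{H}}}\sum_{i=1}^N\Big((K_i+2\pi\beta_i)-s_\alpha^{\mathbb{H}}\tanh^\alpha\frac{r_i}{2}\Big)\,\mathrm{d}u_i^{\mathbb{H}},\qquad u^{\mathbb{H}}\in\mathbb{R}_{<0}^N,$$ is strictly convex in $\mathbb{R}_{<0}^N$.
   Context: $M$ is a closed connected surface with a triangulation $\mathcal{T}=\{V,E,F\}$, $V=\{v_1,\dots,v_N\}$, and a weight $\Phi:E\to[0,\pi/2]$, $\Phi_{ij}=\Phi(e_{ij})$. A circle packing metric is a function $r=(r_1,\dots,r_N)^T:V\to(0,+\infty)$. In hyperbolic background geometry $\mathbb{H}^2$ the edge $e_{ij}$ has length $l_{ij}=\cosh^{-1}(\cosh r_i\cosh r_j+\sinh r_i\sinh r_j\cos\Phi_{ij})$; each face $\Delta_{ijk}$ is then a hyperbolic triangle, $\theta_i^{ijk}$ is its inner angle at $v_i$, and $K_i=2\pi-\sum_{f_{ijk}\in F}\theta_i^{ijk}$ (sum over all triangles having $v_i$ as a vertex). Branch structure: a (possibly empty) set $\{(b_1,\beta_1),\dots,(b_m,\beta_m)\}$ of distinct vertices with orders $\beta_j\in\mathbb{Z}_{>0}$; write $\beta_i$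 for the order at $v_i$, with $\beta_i=0$ if $v_i$ is not one of the $b_j$. It is a branch structure if each simple closed path $\Gamma=\{e_1,\dots,e_n\}$ in $\mathcal{T}$ satisfies $\sum_{j=1}^n[\pi-\Phi(e_j)]>2(l(\Gamma)+1)\pi$, where $l(\Gamma)$ is the sum of the orders of the branch points enclosed by $\Gamma$. Notation: $u_i^{\mathbb{H}}=\ln\tanh\frac{r_i}{2}$; $s_\alpha^{\mathbb{H}}=2\pi\chi(M)/\|\tanh\frac r2\|_\alpha^\alpha$ with $\|\tanh\frac r2\|_\alpha^\alpha=\sum_{i=1}^N\tanh^\alpha\frac{r_i}{2}$; $u_*^{\mathbb{H}}\in\mathbb{R}_{<0}^N$ is an arbitrarily chosen base point. The integral is the line integral of a (closed) 1-form on $\mathbb{R}_{<0}^N$ along any path from $u_*^{\mathbb{H}}$ to $u^{\mathbb{H}}$. *)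

theory Defs
  imports "HOL-Analysis.Analysis"
begin

section \<open>Triangulated closed surfaces\<close>

definition closed_connected_surface :: "'m topology \<Rightarrow> bool" where
  "closed_connected_surface M \<longleftrightarrow>
     topspace M \<noteq> {} \<and> compact_space M \<and> connected_space M \<and>
     Hausdorff_space M \<and> second_countable M \<and>
     (\<forall>x\<in>topspace M. \<exists>U. openin M U \<and> x \<in> U \<and>
        subtopology M U homeomorphic_space (euclidean :: (real^2) topology))"

text \<open>The vertex set \<open>v\<^sub>1, \<dots>, v\<^sub>N\<close> is the finite type \<open>'v\<close> (so \<open>N = CARD('v)\<close>); an edge is
  the set of its two endpoints and a face the set of its three vertices. The vertices are kept
  implicit: every singleton is a simplex.\<close>

definition simplices :: "'v set set \<Rightarrow> 'v set set \<Rightarrow> 'v set set" where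
  "simplices E F = range (\<lambda>v. {v}) \<union> E \<union> F"

definition two_complex :: "'v set set \<Rightarrow> 'v set set \<Rightarrow> bool" where
  "two_complex E F \<longleftrightarrow>
     (\<forall>e\<in>E. card e = 2) \<and> (\<forall>f\<in>F. card f = 3) \<and>
     (\<forall>f\<in>F. \<forall>e. e \<subseteq> f \<and> card e = 2 \<longrightarrow> e \<in> E)"

text \<open>The geometric realization of a family of simplices, in barycentric coordinates: each point
  lies in the relative interior of the simplex spanned by its support.\<close>

definition realization :: "'v::finite set set \<Rightarrow> (real^'v) set" where
  "realization S = {x. (\<forall>i. 0 \<le> x $ i) \<and> (\<Sum>i\<in>UNIV. x $ i) = 1 \<and> {i. x $ i \<noteq> 0} \<in> S}"

definition surface_triangulation ::
    "'m topology \<Rightarrow> 'v::finite set set \<Rightarrow> 'v set set \<Rightarrow> (real^'v \<Rightarrow> 'm) \<Rightarrow> bool" where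
  "surface_triangulation M E F h \<longleftrightarrow>
     two_complex E F \<and> homeomorphic_map (top_of_set (realization (simplices E F))) M h"

definition euler_char :: "'v::finite set set \<Rightarrow> 'v set set \<Rightarrow> int" where
  "euler_char E F = int CARD('v) - int (card E) + int (card F)"

definition edge_weight :: "'v set set \<Rightarrow> ('v set \<Rightarrow> real) \<Rightarrow> bool" where
  "edge_weight E \<Phi> \<longleftrightarrow> (\<forall>e\<in>E. 0 \<le> \<Phi> e \<and> \<Phi> e \<le> pi / 2)"


section \<open>Branch structures\<close>

text \<open>A simple closed edge path is given by the cyclic list of the vertices it visits.\<close>

definition path_edge :: "'v list \<Rightarrow> nat \<Rightarrow> 'v set" where
  "path_edge vs k = {vs ! k, vs ! (Suc k mod length vs)}"

definition simple_closed_path :: "'v set set \<Rightarrow> 'v list \<Rightarrow> bool" where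
  "simple_closed_path E vs \<longleftrightarrow>
     3 \<le> length vs \<and> distinct vs \<and> (\<forall>k<length vs. path_edge vs k \<in> E)"

definition path_trace :: "(real^'v \<Rightarrow> 'm) \<Rightarrow> 'v::finite list \<Rightarrow> 'm set" where
  "path_trace h vs =
     h ` realization ((\<lambda>v. {v}) ` set vs \<union> path_edge vs ` {..<length vs})"

text \<open>A vertex is enclosed by a simple closed path if the path bounds a closed disc embedded in the
  surface whose open disc contains the vertex. A path that bounds no disc encloses nothing.\<close>

definition encloses :: "'m topology \<Rightarrow> (real^'v \<Rightarrow> 'm) \<Rightarrow> 'v::finite list \<Rightarrow> 'v \<Rightarrow> bool" where
  "encloses M h vs v \<longleftrightarrow>
     (\<exists>g. embedding_map (top_of_set (cball (0::complex) 1)) M g \<and>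
          g ` sphere 0 1 = path_trace h vs \<and> h (axis v 1) \<in> g ` ball 0 1)"

text \<open>A set of branch points with positive orders is encoded by its order function \<open>\<beta>\<close>, which
  vanishes exactly at the vertices that are not branch points.\<close>

definition branch_structure ::
    "'m topology \<Rightarrow> 'v::finite set set \<Rightarrow> (real^'v \<Rightarrow> 'm) \<Rightarrow> ('v set \<Rightarrow> real) \<Rightarrow> ('v \<Rightarrow> nat) \<Rightarrow> bool"
where
  "branch_structure M E h \<Phi> \<beta> \<longleftrightarrow>
     (\<forall>vs. simple_closed_path E vs \<longrightarrow>
        (\<Sum>k<length vs. pi - \<Phi> (path_edge vs k)) >
          2 * (real (\<Sum>v | encloses M h vs v. \<beta> v) + 1) * pi)"


section \<open>The hyperbolic plane\<close>

text \<open>The hyperboloid model in \<open>\<real> \<times> \<complex>\<close>, the first factor being the time coordinate.\<close>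

definition lorentz :: "real \<times> complex \<Rightarrow> real \<times> complex \<Rightarrow> real" where
  "lorentz p q = snd p \<bullet> snd q - fst p * fst q"

definition hyp_plane :: "(real \<times> complex) set" where
  "hyp_plane = {p. lorentz p p = -1 \<and> 0 < fst p}"

definition hyp_dist :: "real \<times> complex \<Rightarrow> real \<times> complex \<Rightarrow> real" where
  "hyp_dist p q = arcosh (- lorentz p q)"

text \<open>For \<open>p \<noteq> q\<close> in the plane, \<open>q + \<langle>p, q\<rangle> p\<close> is orthogonal to \<open>p\<close> and points along the geodesic
  from \<open>p\<close> to \<open>q\<close>; the form is positive definite on the tangent space at \<open>p\<close>.\<close>

definition hyp_direction :: "real \<times> complex \<Rightarrow> real \<times> complex \<Rightarrow> real \<times> complex" where
  "hyp_direction p q = q + lorentz p q *\<^sub>R p"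

text \<open>The angle at \<open>p\<close> between the geodesics from \<open>p\<close> to \<open>q\<close> and from \<open>p\<close> to \<open>s\<close>.\<close>

definition hyp_angle :: "real \<times> complex \<Rightarrow> real \<times> complex \<Rightarrow> real \<times> complex \<Rightarrow> real" where
  "hyp_angle q p s =
     (let x = hyp_direction p q; y = hyp_direction p s
      in arccos (lorentz x y / (sqrt (lorentz x x) * sqrt (lorentz y y))))"


section \<open>Hyperbolic circle packing metrics and their curvatures\<close>

definition edge_length :: "('v set \<Rightarrow> real) \<Rightarrow> ('v \<Rightarrow> real) \<Rightarrow> 'v \<Rightarrow> 'v \<Rightarrow> real" where
  "edge_length \<Phi> r i j =
     arcosh (cosh (r i) * cosh (r j) + sinh (r i) * sinh (r j) * cos (\<Phi> {i, j}))"

text \<open>The inner angle at \<open>i\<close> of a face \<open>f\<close>: the angle in any geodesic triangle of the hyperbolic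
  plane with the prescribed edge lengths.\<close>

definition inner_angle :: "('v set \<Rightarrow> real) \<Rightarrow> ('v \<Rightarrow> real) \<Rightarrow> 'v set \<Rightarrow> 'v \<Rightarrow> real" where
  "inner_angle \<Phi> r f i =
     (THE \<theta>. \<exists>P j k. f = {i, j, k} \<and> (\<forall>x\<in>f. P x \<in> hyp_plane) \<and>
        (\<forall>x\<in>f. \<forall>y\<in>f. x \<noteq> y \<longrightarrow> hyp_dist (P x) (P y) = edge_length \<Phi> r x y) \<and>
        \<theta> = hyp_angle (P j) (P i) (P k))"

definition curvature :: "'v set set \<Rightarrow> ('v set \<Rightarrow> real) \<Rightarrow> ('v \<Rightarrow> real) \<Rightarrow> 'v \<Rightarrow> real" where
  "curvature F \<Phi> r i = 2 * pi - (\<Sum>f | f \<in> F \<and> i \<in> f. inner_angle \<Phi> r f i)"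

text \<open>All bases below are positive, so \<open>powr\<close> has its usual meaning, also for exponent \<open>0\<close>.\<close>

definition s_alpha :: "'v::finite set set \<Rightarrow> 'v set set \<Rightarrow> real \<Rightarrow> ('v \<Rightarrow> real) \<Rightarrow> real" where
  "s_alpha E F \<alpha> r = 2 * pi * of_int (euler_char E F) / (\<Sum>i\<in>UNIV. tanh (r i / 2) powr \<alpha>)"


section \<open>The branched potential\<close>

definition neg_orthant :: "(real^'v) set" where
  "neg_orthant = {u. \<forall>i. u $ i < 0}"

definition u_coord :: "real \<Rightarrow> real" where
  "u_coord \<rho> = ln (tanh (\<rho> / 2))"

definition radius_of :: "real^'v \<Rightarrow> 'v \<Rightarrow> real" where
  "radius_of u i = the_inv_into {0<..} u_coord (u $ i)"

definition potential_form ::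
    "'v::finite set set \<Rightarrow> 'v set set \<Rightarrow> ('v set \<Rightarrow> real) \<Rightarrow> ('v \<Rightarrow> nat) \<Rightarrow> real \<Rightarrow>
     real^'v \<Rightarrow> real^'v" where
  "potential_form E F \<Phi> \<beta> \<alpha> u =
     (let r = radius_of u in
      \<chi> i. (curvature F \<Phi> r i + 2 * pi * real (\<beta> i)) - s_alpha E F \<alpha> r * tanh (r i / 2) powr \<alpha>)"

text \<open>The 1-form \<open>\<Sum>\<^sub>i \<omega>\<^sub>i du\<^sub>i\<close> is represented by the vector field \<open>\<omega>\<close>.\<close>

definition has_line_integral ::
    "(real^'v \<Rightarrow> real^'v) \<Rightarrow> real \<Rightarrow> (real \<Rightarrow> real^'v::finite) \<Rightarrow> bool" where
  "has_line_integral \<omega> y \<gamma> \<longleftrightarrow>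
     ((\<lambda>t. \<Sum>i\<in>UNIV. \<omega> (\<gamma> t) $ i * vector_derivative \<gamma> (at t within {0..1}) $ i)
        has_integral y) {0..1}"

text \<open>The integral from \<open>a\<close> to \<open>u\<close> is the common value of the line integrals along all piecewise
  \<open>C\<^sup>1\<close> paths in \<open>S\<close>; it is unspecified if these do not all exist and agree.\<close>

definition path_independent_integral ::
    "(real^'v) set \<Rightarrow> (real^'v \<Rightarrow> real^'v) \<Rightarrow> real^'v \<Rightarrow> real^'v::finite \<Rightarrow> real" where
  "path_independent_integral S \<omega> a u =
     (THE y. \<forall>\<gamma>. valid_path \<gamma> \<and> path_image \<gamma> \<subseteq> S \<and> pathstart \<gamma> = a \<and> pathfinish \<gamma> = u
        \<longrightarrow> has_line_integral \<omega> y \<gamma>)"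

definition branched_potential ::
    "'v::finite set set \<Rightarrow> 'v set set \<Rightarrow> ('v set \<Rightarrow> real) \<Rightarrow> ('v \<Rightarrow> nat) \<Rightarrow> real \<Rightarrow>
     real^'v \<Rightarrow> real^'v \<Rightarrow> real" where
  "branched_potential E F \<Phi> \<beta> \<alpha> a u =
     path_independent_integral neg_orthant (potential_form E F \<Phi> \<beta> \<alpha>) a u"

definition strictly_convex_on :: "'a::real_vector set \<Rightarrow> ('a \<Rightarrow> real) \<Rightarrow> bool" where
  "strictly_convex_on S f \<longleftrightarrow> convex S \<and>
     (\<forall>x\<in>S. \<forall>y\<in>S. \<forall>t. x \<noteq> y \<and> 0 < t \<and> t < 1 \<longrightarrow>
        f ((1 - t) *\<^sub>R x + t *\<^sub>R y) < (1 - t) * f x + t * f y)"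

end

(* In the coordinates u the angles of a face have a symmetric Jacobian L. Its off-diagonal entries are
   nonnegative, because all cos Phi are, and L_ii = - cosh l_ij L_ij - cosh l_ik L_ik. Hence
     - <L v, v> = sum over edges ij of L_ij ((v_i - v_j)^2 + (cosh l_ij - 1) (v_i^2 + v_j^2)),
   which is positive definite since at most one of the three L_ij vanishes. The term with s_alpha is a
   nonnegative multiple of the softmax map, whose Jacobian is symmetric positive semidefinite. As every
   vertex lies in a face, the whole 1-form has a symmetric positive definite Jacobian, so by the Poincare
   lemma it is the differential of a strictly convex function. *)

theory Submission
  imports Defs
begin

text \<open>Both the inner angle and the potential are definite descriptions, so existence and
  uniqueness must precede any calculus: a triangle with the prescribed lengths must exist in the
  hyperboloid model and its angle must depend on the lengths alone; the line integral must have one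
  value along all piecewise C^1 paths.

  The choice u = ln (tanh (r / 2)) is what makes L symmetric. It gives du = dr / sinh r, so C = cosh
  r and S = sinh r satisfy dC = S^2 du and dS = C S du. In terms of the C's and the hyperbolic
  cosines of the edge lengths, the entries of L are rational up to one common square root of a Gram
  determinant, and every claim about L becomes an algebraic identity.

  At most one L_ij vanishes because L_ij = 0 forces cos Phi_ij = 1 and cos Phi = 0 on the adjacent
  edges, which cannot hold for two edges of a triangle at once.

  That every vertex lies in a face is a topological fact: the combinatorial conditions on E and F
  alone would allow isolated vertices, where no angle contributes to definiteness.\<close>

section \<open>Potentials of symmetric vector fields\<close>

text \<open>With a 1-form represented by its vector field, symmetry of the Jacobian is closedness.
  \<open>W\<close> is a parameter because its sign is needed later. Continuity is asked for one
  direction at a time; linearity in the direction then gives joint continuity.\<close>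

definition symmetric_jacobian ::
    "'a::euclidean_space set \<Rightarrow> ('a \<Rightarrow> 'a) \<Rightarrow> ('a \<Rightarrow> 'a \<Rightarrow> 'a) \<Rightarrow> bool" where
  "symmetric_jacobian S \<omega> W \<longleftrightarrow>
     (\<forall>u\<in>S. (\<omega> has_derivative W u) (at u)) \<and>
     (\<forall>v. continuous_on S (\<lambda>u. W u v)) \<and>
     (\<forall>u\<in>S. \<forall>v w. W u v \<bullet> w = v \<bullet> W u w)"

lemma symmetric_jacobian_cong:
  assumes "symmetric_jacobian S f W" "open S" "\<And>u. u \<in> S \<Longrightarrow> f u = g u"
  shows "symmetric_jacobian S g W"
  using assms has_derivative_transform_within_open[of f _ _ UNIV S g]
  unfolding symmetric_jacobian_def by simp

lemma symmetric_jacobian_const: "symmetric_jacobian S (\<lambda>u. c) (\<lambda>u v. 0)"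
  by (simp add: symmetric_jacobian_def)

lemma symmetric_jacobian_add:
  assumes "symmetric_jacobian S f V" "symmetric_jacobian S g W"
  shows "symmetric_jacobian S (\<lambda>u. f u + g u) (\<lambda>u v. V u v + W u v)"
  using assms unfolding symmetric_jacobian_def
  by (auto simp: inner_add_left inner_add_right intro!: has_derivative_add continuous_on_add)

lemma symmetric_jacobian_scaleR:
  assumes "symmetric_jacobian S f V"
  shows "symmetric_jacobian S (\<lambda>u. c *\<^sub>R f u) (\<lambda>u v. c *\<^sub>R V u v)"
  using assms unfolding symmetric_jacobian_def
  by (auto intro!: has_derivative_scaleR_right continuous_on_scaleR continuous_on_const)

lemma symmetric_jacobian_sum:
  assumes "\<And>i. i \<in> I \<Longrightarrow> symmetric_jacobian S (f i) (V i)"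
  shows "symmetric_jacobian S (\<lambda>u. \<Sum>i\<in>I. f i u) (\<lambda>u v. \<Sum>i\<in>I. V i u v)"
  using assms
  by (induction I rule: infinite_finite_induct)
    (auto intro: symmetric_jacobian_const symmetric_jacobian_add)

lemma linear_expand:
  fixes f :: "'a::euclidean_space \<Rightarrow> 'b::real_vector"
  assumes "linear f" shows "f h = (\<Sum>b\<in>Basis. (h \<bullet> b) *\<^sub>R f b)"
proof -
  have "f h = f (\<Sum>b\<in>Basis. (h \<bullet> b) *\<^sub>R b)" by (simp add: euclidean_representation)
  also have "\<dots> = (\<Sum>b\<in>Basis. (h \<bullet> b) *\<^sub>R f b)"
    by (simp add: linear_sum[OF assms] linear_cmul[OF assms])
  finally show ?thesis .
qed

text \<open>Poincare lemma on a convex set: \<open>G u\<close> integrates the form along the segment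
  from a fixed point \<open>a\<close>, and differentiation under the integral sign recovers
  \<open>\<omega> u\<close>.\<close>

lemma symmetric_jacobian_potential:
  fixes S :: "'a::euclidean_space set"
  assumes "convex S" "open S" "symmetric_jacobian S \<omega> W"
  obtains G :: "'a \<Rightarrow> real" where "\<And>u. u \<in> S \<Longrightarrow> (G has_derivative (\<lambda>h. \<omega> u \<bullet> h)) (at u)"
proof (cases "S = {}")
  case True
  then show ?thesis using that by blast
next
  case False
  then obtain a where a: "a \<in> S" by blast
  have der: "(\<omega> has_derivative W u) (at u)" and sym: "W u v \<bullet> w = v \<bullet> W u w" if "u \<in> S" for u v w
    using assms(3) that by (auto simp: symmetric_jacobian_def)
  have cont: "continuous_on S (\<lambda>u. W u v)" for v
    using assms(3) by (auto simp: symmetric_jacobian_def)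
  have lin: "linear (W u)" if "u \<in> S" for u
    using der[OF that] has_derivative_linear by blast
  define p where "p = (\<lambda>(u, t). a + t *\<^sub>R (u - a))"
  have pS: "p (u, t) \<in> S" if "u \<in> S" "t \<in> {0..1}" for u t
    using convexD_alt[OF assms(1) a that(1), of t] that(2)
    by (simp add: p_def algebra_simps)
  \<comment> \<open>By symmetry of \<open>W\<close>, \<open>k (u, t)\<close> is at once the gradient
    in u of the integrand \<open>f u t\<close> below and the t-derivative of
    \<open>t *\<^sub>R \<omega> (p (u, t))\<close>. The second reading integrates to
    \<open>\<omega> u\<close>.\<close>
  define k where "k = (\<lambda>(u, t). t *\<^sub>R W (p (u, t)) (u - a) + \<omega> (p (u, t)))"
  have contp: "continuous_on X p" for X
    unfolding p_def case_prod_unfold by (intro continuous_intros)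
  have pim: "p ` (S \<times> {0..1}) \<subseteq> S" using pS by auto
  have cont\<omega>: "continuous_on S \<omega>"
    using der by (intro continuous_at_imp_continuous_on) (auto intro: has_derivative_continuous)
  have contk: "continuous_on (S \<times> {0..1}) k"
  proof -
    \<comment> \<open>Expanding the direction u - a in the basis reduces joint continuity to that of
      each \<open>W u b\<close>.\<close>
    have "continuous_on (S \<times> {0..1})
        (\<lambda>z. snd z *\<^sub>R (\<Sum>b\<in>Basis. ((fst z - a) \<bullet> b) *\<^sub>R W (p z) b) + \<omega> (p z))"
      by (intro continuous_intros continuous_on_compose2[OF cont contp pim]
          continuous_on_compose2[OF cont\<omega> contp pim])
    then show ?thesis
    proof (rule continuous_on_eq)
      fix z assume "z \<in> S \<times> {0..1::real}"
      then have "p z \<in> S" using pim by blast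
      then show "snd z *\<^sub>R (\<Sum>b\<in>Basis. ((fst z - a) \<bullet> b) *\<^sub>R W (p z) b) + \<omega> (p z) = k z"
        by (simp add: k_def case_prod_unfold linear_expand[OF lin, symmetric])
    qed
  qed
  define f where "f = (\<lambda>u t. \<omega> (p (u, t)) \<bullet> (u - a))"
  have fder: "((\<lambda>u. f u t) has_derivative blinfun_apply (blinfun_inner_right (k (u, t)))) (at u within S)"
    if "u \<in> S" "t \<in> cbox 0 1" for u t
  proof -
    have q: "p (u, t) \<in> S" using pS that by auto
    have "((\<lambda>u. p (u, t)) has_derivative (\<lambda>h. t *\<^sub>R h)) (at u)"
      unfolding p_def by (auto intro!: derivative_eq_intros)
    from has_derivative_compose[OF this der[OF q]]
    have "((\<lambda>u. f u t) has_derivative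
        (\<lambda>h. \<omega> (p (u, t)) \<bullet> h + W (p (u, t)) (t *\<^sub>R h) \<bullet> (u - a))) (at u)"
      unfolding f_def by (auto intro!: derivative_eq_intros)
    moreover have "\<omega> (p (u, t)) \<bullet> h + W (p (u, t)) (t *\<^sub>R h) \<bullet> (u - a) = k (u, t) \<bullet> h" for h
      unfolding k_def prod.case sym[OF q]
      by (simp add: inner_add_left inner_commute algebra_simps)
    ultimately show ?thesis
      by (simp add: has_derivative_at_withinI)
  qed
  have contpt: "continuous_on {0..1} (\<lambda>t. \<omega> (p (u, t)))" if "u \<in> S" for u
  proof (rule continuous_on_compose2[OF cont\<omega>])
    show "continuous_on {0..1} (\<lambda>t. p (u, t))"
      unfolding p_def by (auto intro!: continuous_intros)
    show "(\<lambda>t. p (u, t)) ` {0..1} \<subseteq> S" using pS that by auto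
  qed
  have fint: "f u integrable_on cbox 0 1" if "u \<in> S" for u
    unfolding f_def using contpt[OF that]
    by (intro integrable_continuous continuous_intros) simp
  have contB: "continuous_on (S \<times> cbox 0 1) (\<lambda>(u, t). blinfun_inner_right (k (u, t)))"
    using contk by (auto simp: case_prod_unfold
        intro!: bounded_linear.continuous_on[OF bounded_linear_blinfun_inner_right])
  have "((\<lambda>u. integral {0..1} (f u)) has_derivative (\<lambda>h. \<omega> u \<bullet> h)) (at u)" if u: "u \<in> S" for u
  proof -
    have "((\<lambda>t. t *\<^sub>R \<omega> (p (u, t))) has_vector_derivative k (u, t)) (at t within {0..1})"
      if "t \<in> {0..1}" for t
    proof -
      have q: "p (u, t) \<in> S" using pS u that by auto
      have "((\<lambda>t. p (u, t)) has_derivative (\<lambda>h. h *\<^sub>R (u - a))) (at t)"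
        unfolding p_def by (auto intro!: derivative_eq_intros)
      from has_derivative_compose[OF this der[OF q]]
      have "((\<lambda>t. t *\<^sub>R \<omega> (p (u, t))) has_derivative
          (\<lambda>h. t *\<^sub>R W (p (u, t)) (h *\<^sub>R (u - a)) + h *\<^sub>R \<omega> (p (u, t)))) (at t)"
        by (auto intro!: derivative_eq_intros)
      moreover have "t *\<^sub>R W (p (u, t)) (h *\<^sub>R (u - a)) + h *\<^sub>R \<omega> (p (u, t)) = h *\<^sub>R k (u, t)" for h
        unfolding k_def prod.case linear_cmul[OF lin[OF q]]
        by (simp only: scaleR_add_right scaleR_left_commute)
      ultimately show ?thesis
        unfolding has_vector_derivative_def by (simp add: has_derivative_at_withinI)
    qed
    then have "(k \<circ> Pair u has_integral \<omega> u) {0..1}"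
      using fundamental_theorem_of_calculus[of 0 1 "\<lambda>t. t *\<^sub>R \<omega> (p (u, t))" "\<lambda>t. k (u, t)"]
      by (simp add: o_def p_def)
    \<comment> \<open>The Leibniz rule takes derivatives as bounded linear maps, so the integral of
      \<open>k\<close> is transported there.\<close>
    then have "((\<lambda>t. blinfun_inner_right (k (u, t))) has_integral blinfun_inner_right (\<omega> u)) {0..1}"
      using has_integral_linear[OF _ bounded_linear_blinfun_inner_right] by (simp add: o_def)
    then have "integral (cbox 0 1) (\<lambda>t. blinfun_inner_right (k (u, t))) = blinfun_inner_right (\<omega> u)"
      by (simp add: integral_unique)
    with leibniz_rule[of S 0 1 f "\<lambda>u t. blinfun_inner_right (k (u, t))", OF fder fint contB u assms(1)]
    have "((\<lambda>u. integral {0..1} (f u)) has_derivative (\<lambda>h. \<omega> u \<bullet> h)) (at u within S)"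
      by simp
    then show ?thesis using at_within_open[OF u assms(2)] by simp
  qed
  with that show ?thesis by blast
qed

text \<open>The fundamental theorem of calculus, off the finitely many corners of a path, gives
  \<open>G u - G a\<close> for every path.\<close>

lemma path_independent_integral_eq:
  fixes S :: "(real^'v::finite) set"
  assumes "convex S" "a \<in> S" "u \<in> S"
    and G: "\<And>x. x \<in> S \<Longrightarrow> (G has_derivative (\<lambda>h. \<omega> x \<bullet> h)) (at x)"
  shows "path_independent_integral S \<omega> a u = G u - G a"
proof -
  have li: "has_line_integral \<omega> (G u - G a) \<gamma>"
    if v: "valid_path \<gamma>" and im: "path_image \<gamma> \<subseteq> S" and "pathstart \<gamma> = a" "pathfinish \<gamma> = u" for \<gamma>
  proof -
    from v obtain T where T: "finite T" "\<gamma> C1_differentiable_on {0..1} - T"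
      and c: "continuous_on {0..1} \<gamma>"
      unfolding valid_path_def piecewise_C1_differentiable_on_def by blast
    have "((\<lambda>t. G (\<gamma> t)) has_vector_derivative
        (\<Sum>i\<in>UNIV. \<omega> (\<gamma> t) $ i * vector_derivative \<gamma> (at t within {0..1}) $ i)) (at t)"
      if t: "t \<in> {0<..<1} - T" for t
    proof -
      have "\<gamma> differentiable at t"
        using T(2) t by (auto simp: C1_differentiable_on_eq)
      then have "(\<gamma> has_vector_derivative vector_derivative \<gamma> (at t)) (at t)"
        by (simp add: vector_derivative_works)
      moreover have "vector_derivative \<gamma> (at t within {0..1}) = vector_derivative \<gamma> (at t)"
        using t by (intro vector_derivative_at_within_ivl calculation) auto
      moreover have "\<gamma> t \<in> S" using im t by (fastforce simp: path_image_def)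
      ultimately have "((\<lambda>t. G (\<gamma> t)) has_derivative
          (\<lambda>h. \<omega> (\<gamma> t) \<bullet> (h *\<^sub>R vector_derivative \<gamma> (at t within {0..1})))) (at t)"
        using has_derivative_compose[of \<gamma> _ t UNIV G, OF _ G]
        unfolding has_vector_derivative_def by metis
      then show ?thesis
        unfolding has_vector_derivative_def inner_scaleR_right real_scaleR_def
        by (simp add: inner_vec_def)
    qed
    moreover have "continuous_on {0..1} (\<lambda>t. G (\<gamma> t))"
    proof (rule continuous_on_compose2[OF _ c])
      show "continuous_on S G"
        using G by (intro continuous_at_imp_continuous_on) (auto intro: has_derivative_continuous)
      show "\<gamma> ` {0..1} \<subseteq> S" using im by (simp add: path_image_def)
    qed
    ultimately show ?thesis
      unfolding has_line_integral_def
      using fundamental_theorem_of_calculus_interior_strong[OF T(1), of 0 1 "\<lambda>t. G (\<gamma> t)"] that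
      by (simp add: pathstart_def pathfinish_def)
  qed
  \<comment> \<open>Uniqueness needs at least one path, since otherwise the condition would hold
    vacuously for every y; convexity provides the segment.\<close>
  have "path_image (linepath a u) \<subseteq> S"
    using closed_segment_subset[OF assms(2,3,1)] by simp
  then have "y = G u - G a"
    if "\<forall>\<gamma>. valid_path \<gamma> \<and> path_image \<gamma> \<subseteq> S \<and> pathstart \<gamma> = a \<and> pathfinish \<gamma> = u
        \<longrightarrow> has_line_integral \<omega> y \<gamma>" for y
    using that[rule_format, of "linepath a u"] li[of "linepath a u"]
    unfolding has_line_integral_def by (auto intro: has_integral_unique)
  with li show ?thesis
    unfolding path_independent_integral_def by (intro the_equality) auto
qed

text \<open>Along a segment with direction d = y - x the second derivative is
  \<open>W (c s) d \<bullet> d\<close>, so the first derivative increases strictly. Mean values on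
  both sides of t then compare the slopes of the two chords.\<close>

lemma strictly_convex_on_positive_jacobian:
  fixes S :: "'a::euclidean_space set"
  assumes "convex S"
    and G: "\<And>x. x \<in> S \<Longrightarrow> (G has_derivative (\<lambda>h. \<omega> x \<bullet> h)) (at x)"
    and W: "\<And>x. x \<in> S \<Longrightarrow> (\<omega> has_derivative W x) (at x)"
    and pos: "\<And>x v. x \<in> S \<Longrightarrow> v \<noteq> 0 \<Longrightarrow> 0 < W x v \<bullet> v"
  shows "strictly_convex_on S G"
  unfolding strictly_convex_on_def
proof (intro conjI ballI allI impI, fact)
  fix x y t assume xy: "x \<in> S" "y \<in> S" and "x \<noteq> y \<and> 0 < t \<and> t < (1::real)"
  then have t: "0 < t" "t < 1" and d: "y - x \<noteq> 0" by auto
  define c where "c s = x + s *\<^sub>R (y - x)" for s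
  have cS: "c s \<in> S" if "0 \<le> s" "s \<le> 1" for s
    using convexD_alt[OF assms(1) xy, of s] that by (simp add: c_def algebra_simps)
  have cd: "(c has_derivative (\<lambda>h. h *\<^sub>R (y - x))) (at s)" for s
    unfolding c_def by (auto intro!: derivative_eq_intros)
  define f where "f s = G (c s)" for s
  define f' where "f' s = \<omega> (c s) \<bullet> (y - x)" for s
  have f: "(f has_real_derivative f' s) (at s)" if "0 \<le> s" "s \<le> 1" for s
    using has_derivative_compose[OF cd G[OF cS[OF that]]]
    unfolding has_field_derivative_def f_def f'_def
    by (rule has_derivative_eq_rhs) (simp add: fun_eq_iff mult.commute)
  have f': "(f' has_real_derivative W (c s) (y - x) \<bullet> (y - x)) (at s)" if "0 \<le> s" "s \<le> 1" for s
  proof -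
    note D = has_derivative_compose[OF cd W[OF cS[OF that]]]
    have "linear (W (c s))" using W[OF cS[OF that]] has_derivative_linear by blast
    with D show ?thesis unfolding f'_def has_field_derivative_def
      by (auto intro!: derivative_eq_intros simp: linear_cmul mult.commute)
  qed
  obtain s1 where s1: "0 < s1" "s1 < t" "f t - f 0 = (t - 0) * f' s1"
    using MVT2[OF t(1), of f f', OF f] t by auto
  obtain s2 where s2: "t < s2" "s2 < 1" "f 1 - f t = (1 - t) * f' s2"
    using MVT2[OF t(2), of f f', OF f] t by auto
  have "f' s1 < f' s2"
  proof (rule DERIV_pos_imp_increasing[where f = f'])
    fix s assume "s1 \<le> s" "s \<le> s2"
    with s1 s2 f'[of s] pos[OF cS[of s] d]
    show "\<exists>y. (f' has_real_derivative y) (at s) \<and> 0 < y" by auto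
  qed (use s1 s2 in auto)
  then have "(1 - t) * (t * f' s1) < t * ((1 - t) * f' s2)"
    using t by simp
  with s1(3) s2(3) have "(1 - t) * (f t - f 0) < t * (f 1 - f t)" by simp
  then have "f t < (1 - t) * f 0 + t * f 1" by (simp add: algebra_simps)
  moreover have "c t = (1 - t) *\<^sub>R x + t *\<^sub>R y" by (simp add: c_def algebra_simps)
  ultimately show "G ((1 - t) *\<^sub>R x + t *\<^sub>R y) < (1 - t) * G x + t * G y"
    by (simp add: f_def) (simp add: c_def)
qed

section \<open>Angles of a hyperbolic triangle of circles\<close>

text \<open>Hyperbolic cosine and sine of the radius \<open>r\<close> in terms of \<open>t = ln (tanh (r / 2))\<close>.\<close>

definition radius_cosh :: "real \<Rightarrow> real" where
  "radius_cosh t = - cosh t / sinh t"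

definition radius_sinh :: "real \<Rightarrow> real" where
  "radius_sinh t = - 1 / sinh t"

lemma radius_sinh_pos: "t < 0 \<Longrightarrow> 0 < radius_sinh t"
  by (simp add: radius_sinh_def divide_neg_neg)

lemma radius_cosh_square: "t < 0 \<Longrightarrow> (radius_cosh t)\<^sup>2 = 1 + (radius_sinh t)\<^sup>2"
  by (simp add: radius_cosh_def radius_sinh_def power_divide cosh_square_eq add_divide_distrib)

lemma radius_cosh_gt_1:
  assumes "t < 0" shows "1 < radius_cosh t"
proof -
  have "0 \<le> radius_cosh t"
    using assms by (simp add: radius_cosh_def divide_nonneg_neg)
  moreover have "1 < (radius_cosh t)\<^sup>2"
    using radius_cosh_square[OF assms] radius_sinh_pos[OF assms] by simp
  ultimately show ?thesis
    using power2_less_imp_less[of 1 "radius_cosh t"] by simp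
qed

text \<open>From t = ln (tanh (r / 2)) one gets dr/dt = sinh r, hence d(cosh r)/dt = (sinh r)^2;
  likewise for \<open>radius_sinh\<close> next.\<close>

lemma radius_cosh_has_derivative [derivative_intros]:
  assumes "(g has_derivative g') (at u within X)" "g u < 0"
  shows "((\<lambda>u. radius_cosh (g u)) has_derivative (\<lambda>h. (radius_sinh (g u))\<^sup>2 * g' h)) (at u within X)"
proof -
  have "(radius_cosh has_real_derivative (radius_sinh (g u))\<^sup>2) (at (g u))"
    unfolding radius_cosh_def [abs_def] radius_sinh_def using assms(2)
    by (auto intro!: derivative_eq_intros simp: power2_eq_square divide_simps)
      (use hyperbolic_pythagoras[of "g u"] in \<open>simp add: power2_eq_square algebra_simps\<close>)
  from DERIV_compose_FDERIV[OF this assms(1)] show ?thesis by (simp add: mult.commute)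
qed

lemma radius_sinh_has_derivative [derivative_intros]:
  assumes "(g has_derivative g') (at u within X)" "g u < 0"
  shows "((\<lambda>u. radius_sinh (g u)) has_derivative
    (\<lambda>h. radius_cosh (g u) * radius_sinh (g u) * g' h)) (at u within X)"
proof -
  have "(radius_sinh has_real_derivative radius_cosh (g u) * radius_sinh (g u)) (at (g u))"
    unfolding radius_sinh_def [abs_def] radius_cosh_def using assms(2)
    by (auto intro!: derivative_eq_intros simp: power2_eq_square divide_simps)
  from DERIV_compose_FDERIV[OF this assms(1)] show ?thesis by (simp add: mult.commute)
qed

lemma continuous_on_radius [continuous_intros]:
  assumes "continuous_on X g" "\<And>u. u \<in> X \<Longrightarrow> g u < 0"
  shows "continuous_on X (\<lambda>u. radius_cosh (g u))" "continuous_on X (\<lambda>u. radius_sinh (g u))"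
  unfolding radius_cosh_def radius_sinh_def
  using assms(2) by (auto intro!: continuous_intros assms(1)) fastforce+

section \<open>The hyperbolic law of cosines and its differential\<close>

definition gram :: "real \<Rightarrow> real \<Rightarrow> real \<Rightarrow> real" where
  "gram x y z = 1 + 2 * x * y * z - x\<^sup>2 - y\<^sup>2 - z\<^sup>2"

text \<open>The law of cosines solved for the angle opposite to the first side; the arguments are
  the hyperbolic cosines of the sides, so the square roots are their hyperbolic sines.\<close>

definition opposite_angle :: "real \<Rightarrow> real \<Rightarrow> real \<Rightarrow> real" where
  "opposite_angle x y z = arccos ((y * z - x) / (sqrt (y\<^sup>2 - 1) * sqrt (z\<^sup>2 - 1)))"

lemma opposite_angle_commute: "opposite_angle x z y = opposite_angle x y z"
  by (simp add: opposite_angle_def mult.commute)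

lemma one_less_square: "1 < x \<Longrightarrow> 1 < x\<^sup>2" for x :: real
  by simp

text \<open>\<open>gram\<close> is the determinant of the symmetric 3x3 matrix with unit diagonal
  and off-diagonal entries x, y, z. In this form it measures how far the cosine in
  \<open>opposite_angle\<close> stays from -1 and 1, where arccos is not differentiable.\<close>

lemma gram_eq: "gram x y z = (y\<^sup>2 - 1) * (z\<^sup>2 - 1) - (y * z - x)\<^sup>2"
  by (simp add: gram_def power2_eq_square algebra_simps)

lemma cos_opposite_angle_bounds:
  assumes "1 < y" "1 < z" "0 < gram x y z"
  defines "c \<equiv> (y * z - x) / (sqrt (y\<^sup>2 - 1) * sqrt (z\<^sup>2 - 1))"
  shows "-1 < c" "c < 1"
    and "sqrt (1 - c\<^sup>2) = sqrt (gram x y z) / (sqrt (y\<^sup>2 - 1) * sqrt (z\<^sup>2 - 1))"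
proof -
  have yz: "0 < y\<^sup>2 - 1" "0 < z\<^sup>2 - 1"
    using assms one_less_square by auto
  have "c\<^sup>2 = (y * z - x)\<^sup>2 / ((y\<^sup>2 - 1) * (z\<^sup>2 - 1))"
    using yz by (simp add: c_def power_divide power_mult_distrib)
  then have "1 - c\<^sup>2 = gram x y z / ((y\<^sup>2 - 1) * (z\<^sup>2 - 1))"
    using yz by (simp add: gram_eq diff_divide_distrib)
  moreover from this have "c\<^sup>2 < 1"
    using yz assms(3) by (smt (verit) divide_pos_pos mult_pos_pos)
  ultimately show "-1 < c" "c < 1"
    and "sqrt (1 - c\<^sup>2) = sqrt (gram x y z) / (sqrt (y\<^sup>2 - 1) * sqrt (z\<^sup>2 - 1))"
    by (auto simp: abs_square_less_1 real_sqrt_divide real_sqrt_mult)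
qed

text \<open>For sides a, b, c and opposite angles A, B, C this is the classical sinh b sinh c sin A
  dA = sinh a (da - cos C db - cos B dc), written in x = cosh a, y = cosh b, z = cosh c. The factor
  sinh b sinh c sin A is the square root of \<open>gram x y z\<close>.\<close>

lemma opposite_angle_has_derivative:
  assumes "(X has_derivative X') (at u)" "(Y has_derivative Y') (at u)" "(Z has_derivative Z') (at u)"
    and yz: "1 < Y u" "1 < Z u" and gr: "0 < gram (X u) (Y u) (Z u)"
  shows "((\<lambda>u. opposite_angle (X u) (Y u) (Z u)) has_derivative
    (\<lambda>h. (X' h - (X u * Y u - Z u) / ((Y u)\<^sup>2 - 1) * Y' h - (X u * Z u - Y u) / ((Z u)\<^sup>2 - 1) * Z' h)
           / sqrt (gram (X u) (Y u) (Z u)))) (at u)"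
proof -
  define q where "q = (\<lambda>u. (Y u * Z u - X u) / (sqrt ((Y u)\<^sup>2 - 1) * sqrt ((Z u)\<^sup>2 - 1)))"
  define sy sz where "sy = sqrt ((Y u)\<^sup>2 - 1)" and "sz = sqrt ((Z u)\<^sup>2 - 1)"
  have pos: "0 < (Y u)\<^sup>2 - 1" "0 < (Z u)\<^sup>2 - 1"
    using yz one_less_square by auto
  have s: "0 < sy" "0 < sz" "sy\<^sup>2 = (Y u)\<^sup>2 - 1" "sz\<^sup>2 = (Z u)\<^sup>2 - 1"
    using pos by (auto simp: sy_def sz_def)
  have dsy: "((\<lambda>u. sqrt ((Y u)\<^sup>2 - 1)) has_derivative (\<lambda>h. Y u * Y' h / sy)) (at u)"
    using pos by (auto intro!: derivative_eq_intros assms(1-3) simp: sy_def field_simps)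
  have dsz: "((\<lambda>u. sqrt ((Z u)\<^sup>2 - 1)) has_derivative (\<lambda>h. Z u * Z' h / sz)) (at u)"
    using pos by (auto intro!: derivative_eq_intros assms(1-3) simp: sz_def field_simps)
  define n where "n h = X' h - (X u * Y u - Z u) / sy\<^sup>2 * Y' h - (X u * Z u - Y u) / sz\<^sup>2 * Z' h" for h
  have "(q has_derivative (\<lambda>h. ((Y' h * Z u + Y u * Z' h - X' h) * (sy * sz)
      - (Y u * Z u - X u) * (Y u * Y' h / sy * sz + sy * (Z u * Z' h / sz))) / (sy * sz)\<^sup>2)) (at u)"
    unfolding q_def using s
    by (auto intro!: derivative_eq_intros assms(1-3) dsy dsz simp flip: sy_def sz_def)
      (use pos in \<open>auto simp: fun_eq_iff power2_eq_square field_simps\<close>)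
  moreover have "((Y' h * Z u + Y u * Z' h - X' h) * (sy * sz)
      - (Y u * Z u - X u) * (Y u * Y' h / sy * sz + sy * (Z u * Z' h / sz))) / (sy * sz)\<^sup>2
      = - n h / (sy * sz)" for h
  proof -
    have "((Y' h * Z u + Y u * Z' h - X' h) * (sy * sz)
      - (Y u * Z u - X u) * (Y u * Y' h / sy * sz + sy * (Z u * Z' h / sz))) / (sy * sz)\<^sup>2
      = (Y' h * Z u + Y u * Z' h - X' h
          - (Y u * Z u - X u) * (Y u * Y' h / sy\<^sup>2 + Z u * Z' h / sz\<^sup>2)) / (sy * sz)"
      using s(1,2) by (simp add: field_simps power2_eq_square)
    also have "Y' h * Z u + Y u * Z' h - X' h
          - (Y u * Z u - X u) * (Y u * Y' h / sy\<^sup>2 + Z u * Z' h / sz\<^sup>2) = - n h"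
      unfolding n_def s(3,4) using pos
      by (simp add: divide_simps) (simp add: algebra_simps power2_eq_square)
    finally show ?thesis .
  qed
  ultimately have q: "(q has_derivative (\<lambda>h. - n h / (sy * sz))) (at u)" by simp
  note b = cos_opposite_angle_bounds[OF yz gr, folded sy_def sz_def]
  have qu: "q u = (Y u * Z u - X u) / (sy * sz)" by (simp add: q_def sy_def sz_def)
  have "(arccos has_real_derivative inverse (- sqrt (1 - (q u)\<^sup>2))) (at (q u))"
    using b(1,2) by (intro DERIV_arccos) (simp_all add: qu)
  from DERIV_compose_FDERIV[OF this q]
  have "((\<lambda>u. arccos (q u)) has_derivative (\<lambda>h. n h / sqrt (gram (X u) (Y u) (Z u)))) (at u)"
    unfolding qu b(3) using s(1,2) gr by (simp add: field_simps)
  then show ?thesis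
    by (simp add: opposite_angle_def q_def n_def s(3,4))
qed



section \<open>Positivity when the cosines of the weights lie in [0, 1]\<close>

text \<open>The left side is the numerator of the derivative of the angle at vertex 1 with respect to \<open>u\<^sub>2\<close>;
  if \<open>a, b, c \<in> [0, 1]\<close>, every term on the right is nonnegative.\<close>

lemma coupling_numerator:
  fixes C1 C2 C3 S1 S2 S3 a b c :: real
  assumes "C1\<^sup>2 = 1 + S1\<^sup>2" "C2\<^sup>2 = 1 + S2\<^sup>2"
  defines "x \<equiv> C2 * C3 + S2 * S3 * a" and "y \<equiv> C1 * C3 + S1 * S3 * b"
    and "z \<equiv> C1 * C2 + S1 * S2 * c"
  shows "C1 * (x * z - y) + C2 * (y * z - x) - C3 * (z\<^sup>2 - 1) =
    C3 * S1\<^sup>2 * S2\<^sup>2 * (1 - c\<^sup>2)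
    + S3 * (a * S2 * (S1\<^sup>2 * C2 + C1 * S1 * S2 * c) + b * S1 * (S2\<^sup>2 * C1 + C2 * S1 * S2 * c))"
proof -
  \<comment> \<open>These are the derivatives of z with respect to the two coordinates u of its
    endpoints; grouped by them, the left side is linear in x and y.\<close>
  define p q where "p = C1 * z - C2" and "q = C2 * z - C1"
  have p: "p = S1\<^sup>2 * C2 + C1 * S1 * S2 * c"
    using assms(1) by (simp add: p_def z_def power2_eq_square) algebra
  have q: "q = S2\<^sup>2 * C1 + C2 * S1 * S2 * c"
    using assms(2) by (simp add: q_def z_def power2_eq_square) algebra
  have "C2 * p + C1 * q - z\<^sup>2 + 1 = (C1\<^sup>2 - 1) * (C2\<^sup>2 - 1) - (z - C1 * C2)\<^sup>2"
    by (simp add: p_def q_def power2_eq_square algebra_simps)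
  also have "\<dots> = S1\<^sup>2 * S2\<^sup>2 * (1 - c\<^sup>2)"
    using assms(1,2) by (simp add: z_def power2_eq_square algebra_simps)
  finally have e: "C2 * p + C1 * q - z\<^sup>2 + 1 = S1\<^sup>2 * S2\<^sup>2 * (1 - c\<^sup>2)" .
  have "C1 * (x * z - y) + C2 * (y * z - x) - C3 * (z\<^sup>2 - 1) = x * p + y * q - C3 * (z\<^sup>2 - 1)"
    by (simp add: p_def q_def algebra_simps)
  also have "\<dots> = C3 * (C2 * p + C1 * q - z\<^sup>2 + 1) + S3 * (a * S2 * p + b * S1 * q)"
    by (simp add: x_def y_def algebra_simps)
  finally show ?thesis unfolding e unfolding p q by (simp add: mult.assoc)
qed

text \<open>Such weights always yield a nondegenerate triangle. As x and y are linear in C3 and S3,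
  the determinant expands in C3 and S3. Its only negative terms come from a^2 S2^2 + b^2 S1^2, and
  these are outweighed by z^2 - 1, because z is at least C1 C2.\<close>

lemma gram_pos:
  fixes C1 C2 C3 S1 S2 S3 a b c :: real
  assumes C: "C1\<^sup>2 = 1 + S1\<^sup>2" "C2\<^sup>2 = 1 + S2\<^sup>2" "C3\<^sup>2 = 1 + S3\<^sup>2"
    and pos: "1 < C1" "1 < C2" "1 < C3" "0 < S1" "0 < S2" "0 < S3"
    and abc: "a \<in> {0..1}" "b \<in> {0..1}" "c \<in> {0..1}"
  defines "x \<equiv> C2 * C3 + S2 * S3 * a" and "y \<equiv> C1 * C3 + S1 * S3 * b"
    and "z \<equiv> C1 * C2 + S1 * S2 * c"
  shows "0 < gram x y z"
proof -
  \<comment> \<open>\<open>e\<close> is the value of \<open>gram C1 C2 z\<close>, the part of the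
    determinant that survives at S3 = 0.\<close>
  define p q e where "p = C1 * z - C2" and "q = C2 * z - C1" and "e = S1\<^sup>2 * S2\<^sup>2 * (1 - c\<^sup>2)"
  have "p = S1\<^sup>2 * C2 + C1 * S1 * S2 * c"
    using C(1) by (simp add: p_def z_def power2_eq_square) algebra
  then have p: "0 \<le> p" using pos abc by simp
  have "q = S2\<^sup>2 * C1 + C2 * S1 * S2 * c"
    using C(2) by (simp add: q_def z_def power2_eq_square) algebra
  then have q: "0 \<le> q" using pos abc by simp
  have e: "0 \<le> e" using abc by (simp add: e_def power_le_one)
  have "(C1\<^sup>2 - 1) * (C2\<^sup>2 - 1) - (z - C1 * C2)\<^sup>2 = e"
    using C(1,2) by (simp add: z_def e_def power2_eq_square algebra_simps)
  then have e': "C1\<^sup>2 + C2\<^sup>2 - 2 * C1 * C2 * z = 1 - z\<^sup>2 - e"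
    by (simp add: power2_eq_square algebra_simps)
  have "C1 * C2 \<le> z" using pos abc by (simp add: z_def)
  then have "(C1 * C2)\<^sup>2 \<le> z\<^sup>2" using pos by (intro power_mono) auto
  then have zz: "S1\<^sup>2 + S2\<^sup>2 + S1\<^sup>2 * S2\<^sup>2 \<le> z\<^sup>2 - 1"
    by (simp add: power_mult_distrib C(1,2) algebra_simps)
  have "0 < C1 * C2" using pos by simp
  then have z: "0 \<le> z" using \<open>C1 * C2 \<le> z\<close> by linarith
  have "gram x y z = (1 - z\<^sup>2) - (x\<^sup>2 + y\<^sup>2 - 2 * x * y * z)"
    by (simp add: gram_def)
  also have "x\<^sup>2 + y\<^sup>2 - 2 * x * y * z = C3\<^sup>2 * (C1\<^sup>2 + C2\<^sup>2 - 2 * C1 * C2 * z)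
      - 2 * C3 * S3 * (S2 * a * p + S1 * b * q)
      + S3\<^sup>2 * (S2\<^sup>2 * a\<^sup>2 + S1\<^sup>2 * b\<^sup>2 - 2 * S1 * S2 * a * b * z)"
    by (simp add: x_def y_def p_def q_def power2_eq_square algebra_simps)
  finally have g: "gram x y z = e + 2 * C3 * S3 * (S2 * a * p + S1 * b * q)
      + S3\<^sup>2 * ((z\<^sup>2 - 1) + e - S2\<^sup>2 * a\<^sup>2 - S1\<^sup>2 * b\<^sup>2 + 2 * S1 * S2 * a * b * z)"
    unfolding e' C(3) by (simp add: algebra_simps)
  have "S2\<^sup>2 * a\<^sup>2 \<le> S2\<^sup>2" "S1\<^sup>2 * b\<^sup>2 \<le> S1\<^sup>2"
    using abc by (auto intro!: mult_left_le power_le_one)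
  moreover have "0 < S1\<^sup>2 * S2\<^sup>2" "0 \<le> 2 * S1 * S2 * a * b * z" using z pos abc by auto
  ultimately have "0 < (z\<^sup>2 - 1) + e - S2\<^sup>2 * a\<^sup>2 - S1\<^sup>2 * b\<^sup>2 + 2 * S1 * S2 * a * b * z"
    using zz e by linarith
  moreover have "0 \<le> 2 * C3 * S3 * (S2 * a * p + S1 * b * q)" using p q pos abc by simp
  ultimately show ?thesis
    using g e pos by (simp add: add_nonneg_pos)
qed

section \<open>The angles of a face as functions of u\<close>

definition cosh_length :: "('v set \<Rightarrow> real) \<Rightarrow> real^'v \<Rightarrow> 'v \<Rightarrow> 'v \<Rightarrow> real" where
  "cosh_length \<Phi> u i j = radius_cosh (u $ i) * radius_cosh (u $ j)
     + radius_sinh (u $ i) * radius_sinh (u $ j) * cos (\<Phi> {i, j})"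

text \<open>The derivative of the angle at \<open>i\<close> of the face \<open>{i, j, k}\<close> with respect to \<open>u\<^sub>j\<close>. The
  derivative with respect to \<open>u\<^sub>i\<close> is minus the sum of those with respect to \<open>u\<^sub>j\<close> and \<open>u\<^sub>k\<close>,
  weighted by the hyperbolic cosines of the edge lengths; this is what \<open>angle_form\<close> below records.\<close>

definition coupling :: "('v set \<Rightarrow> real) \<Rightarrow> real^'v \<Rightarrow> 'v \<Rightarrow> 'v \<Rightarrow> 'v \<Rightarrow> real" where
  "coupling \<Phi> u i j k =
     (let x = cosh_length \<Phi> u j k; y = cosh_length \<Phi> u i k; z = cosh_length \<Phi> u i j
      in (radius_cosh (u $ i) * (x * z - y) + radius_cosh (u $ j) * (y * z - x)
            - radius_cosh (u $ k) * (z\<^sup>2 - 1)) / (sqrt (gram x y z) * (z\<^sup>2 - 1)))"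

lemma cosh_length_commute: "cosh_length \<Phi> u j i = cosh_length \<Phi> u i j"
  by (simp add: cosh_length_def insert_commute mult.commute)

text \<open>The reciprocity behind closedness of the 1-form: the derivative of the angle at i in u_j
  equals that of the angle at j in u_i. In the chosen formula, exchanging i and j merely exchanges x
  and y.\<close>

lemma coupling_commute: "coupling \<Phi> u j i k = coupling \<Phi> u i j k"
proof -
  have "gram x y z = gram y x z" for x y z by (simp add: gram_def)
  then show ?thesis
    by (simp add: coupling_def Let_def cosh_length_commute[of \<Phi> u j i])
qed

definition angle_form :: "('v set \<Rightarrow> real) \<Rightarrow> real^'v \<Rightarrow> 'v \<Rightarrow> 'v \<Rightarrow> 'v \<Rightarrow> real^'v \<Rightarrow> real" where
  "angle_form \<Phi> u i j k h = coupling \<Phi> u i j k * (h $ j - cosh_length \<Phi> u i j * h $ i)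
     + coupling \<Phi> u i k j * (h $ k - cosh_length \<Phi> u i k * h $ i)"

text \<open>A face with an ordering of its corners. Facts are proved at the corner i or the edge ij
  and moved to the others by interpreting the locale at reordered corners.\<close>

locale acute_triangle =
  fixes \<Phi> :: "'v::finite set \<Rightarrow> real" and i j k :: 'v
  assumes distinct: "i \<noteq> j" "i \<noteq> k" "j \<noteq> k"
    and weights: "cos (\<Phi> {i, j}) \<in> {0..1}" "cos (\<Phi> {i, k}) \<in> {0..1}" "cos (\<Phi> {j, k}) \<in> {0..1}"
begin

lemma rotate: "acute_triangle \<Phi> j k i" "acute_triangle \<Phi> k i j"
  using distinct weights by unfold_locales (simp_all add: insert_commute)

lemma cosh_length_gt_1:
  assumes "u \<in> neg_orthant" shows "1 < cosh_length \<Phi> u i j"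
proof -
  have n: "u $ i < 0" "u $ j < 0" using assms by (auto simp: neg_orthant_def)
  have "1 < radius_cosh (u $ i) * radius_cosh (u $ j)"
    using n by (intro less_1_mult radius_cosh_gt_1)
  moreover have "0 \<le> radius_sinh (u $ i) * radius_sinh (u $ j) * cos (\<Phi> {i, j})"
    using n[THEN radius_sinh_pos] weights by simp
  ultimately show ?thesis by (simp add: cosh_length_def)
qed

lemma gram_lengths_pos:
  assumes "u \<in> neg_orthant"
  shows "0 < gram (cosh_length \<Phi> u j k) (cosh_length \<Phi> u i k) (cosh_length \<Phi> u i j)"
proof -
  have n: "u $ l < 0" for l using assms by (auto simp: neg_orthant_def)
  show ?thesis
    unfolding cosh_length_def using n weights
    by (intro gram_pos radius_cosh_square radius_cosh_gt_1 radius_sinh_pos) auto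
qed

text \<open>By \<open>coupling_numerator\<close> the coupling is a sum of nonnegative terms over a
  positive denominator. If it vanishes, each term does, and the cofactors of 1 - c^2 and of b are
  positive.\<close>

lemma
  assumes "u \<in> neg_orthant"
  shows coupling_nonneg: "0 \<le> coupling \<Phi> u i j k"
    and coupling_eq_0:
      "coupling \<Phi> u i j k = 0 \<Longrightarrow> cos (\<Phi> {i, j}) = 1 \<and> cos (\<Phi> {i, k}) = 0"
proof -
  have n: "u $ l < 0" for l using assms by (auto simp: neg_orthant_def)
  note C = n[THEN radius_cosh_gt_1] and S = n[THEN radius_sinh_pos]
  let ?c = "cos (\<Phi> {i, j})" and ?b = "cos (\<Phi> {i, k})" and ?a = "cos (\<Phi> {j, k})"
  define Ci Cj Ck Si Sj Sk where "Ci = radius_cosh (u $ i)" "Cj = radius_cosh (u $ j)"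
    "Ck = radius_cosh (u $ k)" "Si = radius_sinh (u $ i)" "Sj = radius_sinh (u $ j)"
    "Sk = radius_sinh (u $ k)"
  note defs = this
  have pos: "0 < Ci" "0 < Cj" "0 < Ck" "0 < Si" "0 < Sj" "0 < Sk"
    using C S by (auto simp: defs intro: less_trans[OF zero_less_one])
  define d where "d = sqrt (gram (cosh_length \<Phi> u j k) (cosh_length \<Phi> u i k) (cosh_length \<Phi> u i j))
    * ((cosh_length \<Phi> u i j)\<^sup>2 - 1)"
  have d: "0 < d"
    using gram_lengths_pos[OF assms] one_less_square[OF cosh_length_gt_1[OF assms]]
    by (simp add: d_def)
  have eq: "coupling \<Phi> u i j k = (Ck * Si\<^sup>2 * Sj\<^sup>2 * (1 - ?c\<^sup>2)
    + Sk * (?a * Sj * (Si\<^sup>2 * Cj + Ci * Si * Sj * ?c) + ?b * Si * (Sj\<^sup>2 * Ci + Cj * Si * Sj * ?c))) / d"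
    unfolding coupling_def Let_def d_def cosh_length_def defs
    by (subst coupling_numerator) (auto simp: radius_cosh_square n)
  have 1: "0 \<le> Ck * Si\<^sup>2 * Sj\<^sup>2 * (1 - ?c\<^sup>2)"
    using pos weights by (simp add: power_le_one)
  have 2: "0 < Si\<^sup>2 * Cj + Ci * Si * Sj * ?c" "0 < Sj\<^sup>2 * Ci + Cj * Si * Sj * ?c"
    using pos weights by (auto intro!: add_pos_nonneg)
  have 3: "0 \<le> ?a * Sj * (Si\<^sup>2 * Cj + Ci * Si * Sj * ?c)" "0 \<le> ?b * Si * (Sj\<^sup>2 * Ci + Cj * Si * Sj * ?c)"
    using 2 pos weights by auto
  show "0 \<le> coupling \<Phi> u i j k"
    unfolding eq using 1 3 pos d by simp
  assume "coupling \<Phi> u i j k = 0"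
  then have 4: "Ck * Si\<^sup>2 * Sj\<^sup>2 * (1 - ?c\<^sup>2) + (Sk * (?a * Sj * (Si\<^sup>2 * Cj + Ci * Si * Sj * ?c))
      + Sk * (?b * Si * (Sj\<^sup>2 * Ci + Cj * Si * Sj * ?c))) = 0"
    unfolding eq using d by (simp add: distrib_left)
  have 5: "0 \<le> Sk * (?a * Sj * (Si\<^sup>2 * Cj + Ci * Si * Sj * ?c))"
    "0 \<le> Sk * (?b * Si * (Sj\<^sup>2 * Ci + Cj * Si * Sj * ?c))"
    using 3 pos by simp_all
  from 1 4 5 have "Ck * Si\<^sup>2 * Sj\<^sup>2 * (1 - ?c\<^sup>2) = 0" "Sk * (?b * Si * (Sj\<^sup>2 * Ci + Cj * Si * Sj * ?c)) = 0"
    by linarith+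
  then have "?c\<^sup>2 = 1" "?b = 0"
    using 2 pos by simp_all
  moreover from this weights have "?c = 1" by (auto simp: power2_eq_1_iff)
  ultimately show "?c = 1 \<and> ?b = 0" by simp
qed

end

lemma vec_nth_has_derivative [derivative_intros]:
  "((\<lambda>u. u $ i) has_derivative (\<lambda>h. h $ i)) (at u within X)"
  by (rule bounded_linear_imp_has_derivative[OF bounded_linear_vec_nth])

text \<open>The raw coefficient of \<open>h $ i\<close> is S_i^2 C_j + C_i S_i S_j cos Phi_ij.
  Replacing S_i^2 by C_i^2 - 1 absorbs the weight into the length itself.\<close>

lemma cosh_length_has_derivative:
  assumes "u \<in> neg_orthant"
  shows "((\<lambda>u. cosh_length \<Phi> u i j) has_derivative
    (\<lambda>h. (radius_cosh (u $ i) * cosh_length \<Phi> u i j - radius_cosh (u $ j)) * h $ i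
       + (radius_cosh (u $ j) * cosh_length \<Phi> u i j - radius_cosh (u $ i)) * h $ j)) (at u)"
proof -
  have n: "u $ l < 0" for l using assms by (auto simp: neg_orthant_def)
  note C = radius_cosh_square[OF n]
  have S: "(radius_sinh (u $ l))\<^sup>2 = radius_cosh (u $ l) * radius_cosh (u $ l) - 1" for l
    using C[of l] by (simp add: power2_eq_square)
  show ?thesis
    unfolding cosh_length_def
    by (auto intro!: derivative_eq_intros simp: n S fun_eq_iff) (simp add: algebra_simps S[unfolded power2_eq_square])
qed

text \<open>The left side is the numerator of the angle derivative after inserting the length
  derivatives. Regrouping by hj - z hi and hk - y hi exposes the couplings and shows that the
  coefficient of hi is their negative sum, weighted by the hyperbolic cosines z and y.\<close>

lemma coupling_identity:
  fixes x y z :: real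
  assumes y: "y\<^sup>2 - 1 \<noteq> 0" and z: "z\<^sup>2 - 1 \<noteq> 0"
  shows "((Cj * x - Ck) * hj + (Ck * x - Cj) * hk)
      - (x * y - z) / (y\<^sup>2 - 1) * ((Ci * y - Ck) * hi + (Ck * y - Ci) * hk)
      - (x * z - y) / (z\<^sup>2 - 1) * ((Ci * z - Cj) * hi + (Cj * z - Ci) * hj)
    = (Ci * (x * z - y) + Cj * (y * z - x) - Ck * (z\<^sup>2 - 1)) / (z\<^sup>2 - 1) * (hj - z * hi)
      + (Ci * (x * y - z) + Ck * (z * y - x) - Cj * (y\<^sup>2 - 1)) / (y\<^sup>2 - 1) * (hk - y * hi)"
proof -
  define p q where "p = (x * y - z) / (y\<^sup>2 - 1)" and "q = (x * z - y) / (z\<^sup>2 - 1)"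
  define r s where "r = (y * z - x) / (z\<^sup>2 - 1)" and "s = (z * y - x) / (y\<^sup>2 - 1)"
  \<comment> \<open>With these linear relations between the quotients the claim becomes a polynomial
    identity.\<close>
  have rs: "r = x - z * q" "s = x - y * p" "q = y - z * r" "p = z - y * s"
    using y z by (simp_all add: r_def s_def p_def q_def field_simps)
      (simp_all add: power2_eq_square algebra_simps)
  have 1: "(Ci * (x * z - y) + Cj * (y * z - x) - Ck * (z\<^sup>2 - 1)) / (z\<^sup>2 - 1) = Ci * q + Cj * r - Ck"
    using z by (simp add: q_def r_def divide_simps)
  have 2: "(Ci * (x * y - z) + Ck * (z * y - x) - Cj * (y\<^sup>2 - 1)) / (y\<^sup>2 - 1) = Ci * p + Ck * s - Cj"
    using y by (simp add: p_def s_def divide_simps)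
  have "(Ci * q + Cj * r - Ck) * (hj - z * hi) + (Ci * p + Ck * s - Cj) * (hk - y * hi)
    = (Ci * q + Cj * r - Ck) * hj + (Ci * p + Ck * s - Cj) * hk
      + (Ck * (z - y * s) + Cj * (y - z * r) - Ci * (z * q + y * p)) * hi"
    by (simp add: algebra_simps)
  also have "\<dots> = (Ci * q + Cj * r - Ck) * hj + (Ci * p + Ck * s - Cj) * hk
      + (Ck * p + Cj * q - Ci * (z * q + y * p)) * hi"
    by (simp flip: rs(3,4))
  finally show ?thesis
    unfolding 1 2 p_def[symmetric] q_def[symmetric] by (simp add: rs(1,2) algebra_simps)
qed

definition triangle_angle :: "('v set \<Rightarrow> real) \<Rightarrow> real^'v \<Rightarrow> 'v \<Rightarrow> 'v \<Rightarrow> 'v \<Rightarrow> real" where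
  "triangle_angle \<Phi> u i j k =
     opposite_angle (cosh_length \<Phi> u j k) (cosh_length \<Phi> u i k) (cosh_length \<Phi> u i j)"

definition angle_field :: "('v set \<Rightarrow> real) \<Rightarrow> 'v \<Rightarrow> 'v \<Rightarrow> 'v \<Rightarrow> real^'v \<Rightarrow> real^'v" where
  "angle_field \<Phi> i j k u = axis i (triangle_angle \<Phi> u i j k)
     + axis j (triangle_angle \<Phi> u j k i) + axis k (triangle_angle \<Phi> u k i j)"

definition angle_jacobian :: "('v set \<Rightarrow> real) \<Rightarrow> 'v \<Rightarrow> 'v \<Rightarrow> 'v \<Rightarrow> real^'v \<Rightarrow> real^'v \<Rightarrow> real^'v" where
  "angle_jacobian \<Phi> i j k u h = axis i (angle_form \<Phi> u i j k h)
     + axis j (angle_form \<Phi> u j k i h) + axis k (angle_form \<Phi> u k i j h)"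

lemma continuous_on_cosh_length [continuous_intros]:
  "continuous_on neg_orthant (\<lambda>u. cosh_length \<Phi> u i j)"
  unfolding cosh_length_def by (intro continuous_intros) (auto simp: neg_orthant_def)

lemma axis_eq_scaleR: "axis i a = a *\<^sub>R axis i (1::real)"
  by (simp add: axis_def vec_eq_iff)

context acute_triangle
begin

lemma triangle_angle_has_derivative:
  assumes "u \<in> neg_orthant"
  shows "((\<lambda>u. triangle_angle \<Phi> u i j k) has_derivative angle_form \<Phi> u i j k) (at u)"
proof -
  interpret r: acute_triangle \<Phi> k i j by (rule rotate)
  note one = cosh_length_gt_1[OF assms] r.cosh_length_gt_1[OF assms, unfolded cosh_length_commute[of \<Phi> u k i]]
  note ne = one[THEN one_less_square]
  have g: "gram x z y = gram x y z" for x y z by (simp add: gram_def)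
  show ?thesis
    unfolding triangle_angle_def
  proof (rule has_derivative_eq_rhs[OF opposite_angle_has_derivative[OF cosh_length_has_derivative
        cosh_length_has_derivative cosh_length_has_derivative one(2,1) gram_lengths_pos,
        OF assms assms assms assms]], rule ext)
  qed (subst coupling_identity,
      use ne in \<open>simp_all add: angle_form_def coupling_def Let_def cosh_length_commute[of \<Phi> u k j] g
        add_divide_distrib mult.commute[of "_ - 1" "sqrt _"]\<close>)
qed

lemma continuous_on_coupling: "continuous_on neg_orthant (\<lambda>u. coupling \<Phi> u i j k)"
proof -
  have "sqrt (gram (cosh_length \<Phi> u j k) (cosh_length \<Phi> u i k) (cosh_length \<Phi> u i j))
      * ((cosh_length \<Phi> u i j)\<^sup>2 - 1) \<noteq> 0" if "u \<in> neg_orthant" for u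
    using gram_lengths_pos[OF that] one_less_square[OF cosh_length_gt_1[OF that]] by simp
  then show ?thesis
    unfolding coupling_def Let_def gram_def
    by (intro continuous_intros) (auto simp: neg_orthant_def intro!: continuous_intros)
qed

lemma continuous_on_angle_form: "continuous_on neg_orthant (\<lambda>u. angle_form \<Phi> u i j k h)"
proof -
  interpret r: acute_triangle \<Phi> i k j
    using distinct weights by unfold_locales (simp_all add: insert_commute)
  show ?thesis
    unfolding angle_form_def
    by (intro continuous_intros continuous_on_coupling r.continuous_on_coupling)
qed

text \<open>Collecting terms by edges, which \<open>coupling_commute\<close> permits, makes the
  symmetry in v and w visible and leaves one quadratic form per edge when v = w.\<close>

lemma angle_jacobian_inner:
  "angle_jacobian \<Phi> i j k u v \<bullet> w =
     coupling \<Phi> u i j k * (v $ i * w $ j + v $ j * w $ i - cosh_length \<Phi> u i j * (v $ i * w $ i + v $ j * w $ j))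
   + coupling \<Phi> u i k j * (v $ i * w $ k + v $ k * w $ i - cosh_length \<Phi> u i k * (v $ i * w $ i + v $ k * w $ k))
   + coupling \<Phi> u j k i * (v $ j * w $ k + v $ k * w $ j - cosh_length \<Phi> u j k * (v $ j * w $ j + v $ k * w $ k))"
  by (simp add: angle_jacobian_def angle_form_def inner_add_left inner_axis' coupling_commute[of \<Phi> u j i]
      coupling_commute[of \<Phi> u k i] coupling_commute[of \<Phi> u k j] cosh_length_commute[of \<Phi> u j i]
      cosh_length_commute[of \<Phi> u k i] cosh_length_commute[of \<Phi> u k j]) (simp add: algebra_simps)

lemma angle_field_symmetric_jacobian:
  "symmetric_jacobian neg_orthant (angle_field \<Phi> i j k) (angle_jacobian \<Phi> i j k)"
proof -
  interpret r: acute_triangle \<Phi> j k i by (rule rotate)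
  interpret q: acute_triangle \<Phi> k i j by (rule rotate)
  show ?thesis
    unfolding symmetric_jacobian_def
  proof (intro conjI ballI allI)
    fix u :: "real^'v" assume u: "u \<in> neg_orthant"
    note d = triangle_angle_has_derivative[OF u] r.triangle_angle_has_derivative[OF u]
      q.triangle_angle_has_derivative[OF u]
    show "(angle_field \<Phi> i j k has_derivative angle_jacobian \<Phi> i j k u) (at u)"
      unfolding angle_field_def [abs_def] angle_jacobian_def [abs_def]
      unfolding axis_eq_scaleR[of _ "triangle_angle _ _ _ _ _"] axis_eq_scaleR[of _ "angle_form _ _ _ _ _ _"]
      by (intro has_derivative_add has_derivative_scaleR_left d)
    show "angle_jacobian \<Phi> i j k u v \<bullet> w = v \<bullet> angle_jacobian \<Phi> i j k u w" for v w
      unfolding inner_commute[of v] angle_jacobian_inner by (simp add: algebra_simps)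
  next
    show "continuous_on neg_orthant (\<lambda>u. angle_jacobian \<Phi> i j k u v)" for v
      unfolding angle_jacobian_def axis_eq_scaleR[of _ "angle_form _ _ _ _ _ _"]
      by (intro continuous_intros continuous_on_angle_form r.continuous_on_angle_form
          q.continuous_on_angle_form)
  qed
qed

lemma angle_jacobian_negative:
  assumes "u \<in> neg_orthant"
  shows "angle_jacobian \<Phi> i j k u v \<bullet> v \<le> 0"
    and "v $ i \<noteq> 0 \<Longrightarrow> angle_jacobian \<Phi> i j k u v \<bullet> v < 0"
proof -
  interpret r: acute_triangle \<Phi> j k i by (rule rotate)
  interpret q: acute_triangle \<Phi> k i j by (rule rotate)
  define a b c where "a = coupling \<Phi> u i j k" and "b = coupling \<Phi> u i k j" and "c = coupling \<Phi> u j k i"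
  have abc: "0 \<le> a" "0 \<le> b" "0 \<le> c"
    using coupling_nonneg[OF assms] r.coupling_nonneg[OF assms] q.coupling_nonneg[OF assms]
    by (simp_all add: a_def b_def c_def coupling_commute[of \<Phi> u k i])
  define Q where "Q x s t = (s - t)\<^sup>2 + (x - 1) * (s\<^sup>2 + t\<^sup>2)" for x s t :: real
  have Q0: "0 \<le> Q x s t" if "1 < x" for x s t
    using that by (simp add: Q_def)
  have Q1: "0 < Q x s t" if "1 < x" "s \<noteq> 0" for x s t
  proof -
    have "0 < s\<^sup>2 + t\<^sup>2" using that by (simp add: sum_power2_gt_zero_iff)
    then show ?thesis using that by (simp add: Q_def add_nonneg_pos)
  qed
  note x = cosh_length_gt_1[OF assms] r.cosh_length_gt_1[OF assms]
    q.cosh_length_gt_1[OF assms, unfolded cosh_length_commute[of \<Phi> u k i]]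
  have eq: "angle_jacobian \<Phi> i j k u v \<bullet> v = - (a * Q (cosh_length \<Phi> u i j) (v $ i) (v $ j)
      + b * Q (cosh_length \<Phi> u i k) (v $ i) (v $ k) + c * Q (cosh_length \<Phi> u j k) (v $ j) (v $ k))"
    unfolding angle_jacobian_inner a_def b_def c_def Q_def by (simp add: power2_eq_square algebra_simps)
  show "angle_jacobian \<Phi> i j k u v \<bullet> v \<le> 0"
    unfolding eq neg_le_0_iff_le using abc x by (intro add_nonneg_nonneg mult_nonneg_nonneg Q0)
  assume v: "v $ i \<noteq> 0"
  \<comment> \<open>If the couplings of both edges at i vanished, cos Phi_ik would be 0 by the first
    and 1 by the second.\<close>
  have "0 < a \<or> 0 < b"
  proof (rule ccontr)
    assume "\<not> ?thesis"
    then have "coupling \<Phi> u i j k = 0" "coupling \<Phi> u k i j = 0"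
      using abc by (auto simp: a_def b_def coupling_commute[of \<Phi> u k i])
    then show False
      using coupling_eq_0[OF assms] q.coupling_eq_0[OF assms] by (simp add: insert_commute)
  qed
  then have "0 < a * Q (cosh_length \<Phi> u i j) (v $ i) (v $ j) + b * Q (cosh_length \<Phi> u i k) (v $ i) (v $ k)"
    using abc x v by (auto simp: Q0 Q1 intro: add_pos_nonneg add_nonneg_pos)
  then show "angle_jacobian \<Phi> i j k u v \<bullet> v < 0"
    unfolding eq using abc x Q0[of "cosh_length \<Phi> u j k" "v $ j" "v $ k"]
    by (smt (verit) mult_nonneg_nonneg)
qed

end

section \<open>Realizing the triangle in the hyperboloid model\<close>

lemma lorentz_algebra:
  "lorentz (p + q) s = lorentz p s + lorentz q s" "lorentz s (p + q) = lorentz s p + lorentz s q"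
  "lorentz (c *\<^sub>R p) s = c * lorentz p s" "lorentz s (c *\<^sub>R p) = c * lorentz s p"
  "lorentz (p - q) s = lorentz p s - lorentz q s" "lorentz s (p - q) = lorentz s p - lorentz s q"
  by (simp_all add: lorentz_def inner_add_left inner_add_right inner_diff_left inner_diff_right algebra_simps)

lemma lorentz_commute: "lorentz p q = lorentz q p"
  by (simp add: lorentz_def inner_commute)

text \<open>Reversed Cauchy-Schwarz inequality. It keeps the argument of arcosh in
  \<open>hyp_dist\<close> at least 1, so distances determine Lorentz products.\<close>

lemma lorentz_le_minus_1:
  assumes "p \<in> hyp_plane" "q \<in> hyp_plane"
  shows "lorentz p q \<le> -1"
proof -
  define a b where "a = norm (snd p)" and "b = norm (snd q)"
  have p: "0 < fst p" "(fst p)\<^sup>2 = 1 + a\<^sup>2" and q: "0 < fst q" "(fst q)\<^sup>2 = 1 + b\<^sup>2"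
    using assms by (auto simp: hyp_plane_def lorentz_def a_def b_def power2_eq_square
        simp flip: power2_norm_eq_inner)
  have "(1 + a * b)\<^sup>2 \<le> (fst p * fst q)\<^sup>2"
    unfolding power_mult_distrib p(2) q(2)
    using zero_le_power2[of "a - b"] by (simp add: power2_eq_square algebra_simps)
  then have "1 + a * b \<le> fst p * fst q"
    by (rule power2_le_imp_le) (use p(1) q(1) in simp)
  moreover have "snd p \<bullet> snd q \<le> a * b"
    unfolding a_def b_def by (rule norm_cauchy_schwarz)
  ultimately show ?thesis by (simp add: lorentz_def)
qed

lemma hyp_dist_eq_arcosh_iff:
  assumes "p \<in> hyp_plane" "q \<in> hyp_plane" "1 \<le> x"
  shows "hyp_dist p q = arcosh x \<longleftrightarrow> lorentz p q = - x"
proof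
  assume "hyp_dist p q = arcosh x"
  then have "cosh (arcosh (- lorentz p q)) = cosh (arcosh x)" by (simp add: hyp_dist_def)
  then show "lorentz p q = - x"
    using lorentz_le_minus_1[OF assms(1,2)] assms(3) by simp
qed (simp add: hyp_dist_def)

text \<open>The angle sees only the three mutual Lorentz products, so all triangles with the same
  side lengths share it.\<close>

lemma hyp_angle_eq:
  assumes "p \<in> hyp_plane" "lorentz p q = - z" "lorentz p s = - y" "lorentz q s = - x"
    and "q \<in> hyp_plane" "s \<in> hyp_plane"
  shows "hyp_angle q p s = opposite_angle x y z"
proof -
  have n: "lorentz p p = -1" "lorentz q q = -1" "lorentz s s = -1"
    using assms by (auto simp: hyp_plane_def)
  note l = lorentz_algebra n assms(2-4) lorentz_commute[of q p] lorentz_commute[of s p]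
  have "lorentz (hyp_direction p q) (hyp_direction p q) = z\<^sup>2 - 1"
    "lorentz (hyp_direction p s) (hyp_direction p s) = y\<^sup>2 - 1"
    "lorentz (hyp_direction p q) (hyp_direction p s) = y * z - x"
    unfolding hyp_direction_def by (simp_all add: l power2_eq_square)
  then show ?thesis
    by (simp add: hyp_angle_def opposite_angle_def Let_def mult.commute[of "sqrt (z\<^sup>2 - 1)"])
qed

lemma hyp_triangle_exists:
  assumes "1 < y" "1 < z" "0 < gram x y z"
  obtains p q s where "p \<in> hyp_plane" "q \<in> hyp_plane" "s \<in> hyp_plane"
    "lorentz p q = - z" "lorentz p s = - y" "lorentz q s = - x"
proof -
  define sy sz where "sy = sqrt (y\<^sup>2 - 1)" and "sz = sqrt (z\<^sup>2 - 1)"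
  have s: "0 < sy" "0 < sz" "sy\<^sup>2 = y\<^sup>2 - 1" "sz\<^sup>2 = z\<^sup>2 - 1"
    using assms(1,2)[THEN one_less_square] by (auto simp: sy_def sz_def)
  define c where "c = (y * z - x) / (sy * sz)"
  have "-1 < c" "c < 1"
    using cos_opposite_angle_bounds[OF assms] by (simp_all add: c_def sy_def sz_def)
  then have c: "(sqrt (1 - c\<^sup>2))\<^sup>2 = 1 - c\<^sup>2" by (simp add: abs_square_le_1)
  show ?thesis
  \<comment> \<open>p is the base point of the hyperboloid, q lies over the positive real axis, and
    s lies in the direction whose cosine c is given by the law of cosines.\<close>
  proof (rule that[of "(1, 0)" "(z, complex_of_real sz)" "(y, Complex (sy * c) (sy * sqrt (1 - c\<^sup>2)))"])
    have "(sy * c)\<^sup>2 + (sy * sqrt (1 - c\<^sup>2))\<^sup>2 = sy\<^sup>2"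
      unfolding power_mult_distrib c by (simp add: algebra_simps)
    then show "(y, Complex (sy * c) (sy * sqrt (1 - c\<^sup>2))) \<in> hyp_plane"
      using assms s(3) by (simp add: hyp_plane_def lorentz_def inner_complex_def power2_eq_square)
    show "lorentz (z, complex_of_real sz) (y, Complex (sy * c) (sy * sqrt (1 - c\<^sup>2))) = - x"
      using s(1,2) by (simp add: lorentz_def inner_complex_def c_def mult.commute)
  qed (use assms s(3,4) in \<open>auto simp: hyp_plane_def lorentz_def inner_complex_def power2_eq_square\<close>)
qed

section \<open>Recovering the radii from the coordinates u\<close>

lemma exp_u_coord: "0 < \<rho> \<Longrightarrow> exp (u_coord \<rho>) = tanh (\<rho> / 2)"
  by (simp add: u_coord_def)

lemma radius_of_props:
  assumes "u \<in> neg_orthant"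
  shows "0 < radius_of u i" and "u_coord (radius_of u i) = u $ i"
proof -
  have inj: "inj_on u_coord {0<..}"
  proof (rule inj_onI)
    fix x y :: real assume "x \<in> {0<..}" "y \<in> {0<..}" "u_coord x = u_coord y"
    then have "tanh (x / 2) = tanh (y / 2)"
      using exp_u_coord by (metis greaterThan_iff)
    then show "x = y" by simp
  qed
  \<comment> \<open>The equation ln (tanh (\<rho> / 2)) = u_i solved for \<rho>; it is solvable
    because u_i < 0.\<close>
  define \<rho> where "\<rho> = 2 * artanh (exp (u $ i))"
  have e: "0 < exp (u $ i)" "exp (u $ i) < 1" using assms by (auto simp: neg_orthant_def)
  have "1 < (1 + exp (u $ i)) / (1 - exp (u $ i))" using e by simp
  then have "0 < \<rho>" by (simp add: \<rho>_def artanh_def)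
  moreover have "tanh (\<rho> / 2) = exp (u $ i)"
  proof -
    have "exp (2 * artanh (exp (u $ i))) = (1 + exp (u $ i)) / (1 - exp (u $ i))"
      using e by (simp add: artanh_def add_pos_pos)
    then have "exp (- (2 * artanh (exp (u $ i)))) = (1 - exp (u $ i)) / (1 + exp (u $ i))"
      by (simp add: exp_minus)
    then show ?thesis
      using add_pos_pos[OF zero_less_one e(1)]
      by (simp add: \<rho>_def tanh_real_altdef) (simp add: divide_simps)
  qed
  ultimately have "u $ i \<in> u_coord ` {0<..}"
    by (intro image_eqI[of _ _ \<rho>]) (auto simp: u_coord_def)
  with inj show "0 < radius_of u i" "u_coord (radius_of u i) = u $ i"
    unfolding radius_of_def
    using the_inv_into_into[OF inj, of "u $ i" "{0<..}"] f_the_inv_into_f[OF inj] by auto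
qed

lemma tanh_radius_of:
  assumes "u \<in> neg_orthant" shows "tanh (radius_of u i / 2) = exp (u $ i)"
  using radius_of_props[OF assms, of i] exp_u_coord by metis

lemma cosh_sinh_radius_of:
  assumes "u \<in> neg_orthant"
  shows "cosh (radius_of u i) = radius_cosh (u $ i)" "sinh (radius_of u i) = radius_sinh (u $ i)"
proof -
  define a where "a = radius_of u i / 2"
  have a: "0 < a" "exp (u $ i) = tanh a"
    using radius_of_props[OF assms, of i] tanh_radius_of[OF assms, of i] by (simp_all add: a_def)
  have pos: "0 < sinh a" "0 < cosh a" using a by auto
  have e: "exp (u $ i) = sinh a / cosh a" "exp (- (u $ i)) = cosh a / sinh a"
    using a by (simp_all add: tanh_def exp_minus)
  have c: "cosh (u $ i) = ((cosh a)\<^sup>2 + (sinh a)\<^sup>2) / (2 * sinh a * cosh a)"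
    unfolding cosh_field_def[of "u $ i"] e using pos by (simp add: field_simps power2_eq_square)
  have "sinh (u $ i) = ((sinh a)\<^sup>2 - (cosh a)\<^sup>2) / (2 * sinh a * cosh a)"
    unfolding sinh_field_def[of "u $ i"] e using pos by (simp add: field_simps power2_eq_square)
  then have s: "sinh (u $ i) = - 1 / (2 * sinh a * cosh a)"
    by (simp add: cosh_square_eq)
  have r: "radius_of u i = 2 * a" by (simp add: a_def)
  show "cosh (radius_of u i) = radius_cosh (u $ i)" "sinh (radius_of u i) = radius_sinh (u $ i)"
    unfolding r radius_cosh_def radius_sinh_def c s cosh_double sinh_double using pos by simp_all
qed

lemma edge_length_radius_of:
  "u \<in> neg_orthant \<Longrightarrow> edge_length \<Phi> (radius_of u) i j = arcosh (cosh_length \<Phi> u i j)"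
  by (simp add: edge_length_def cosh_length_def cosh_sinh_radius_of)

context acute_triangle
begin

text \<open>\<open>hyp_triangle_exists\<close> supplies a triangle for the definite description and
  \<open>hyp_angle_eq\<close> makes its angle unique. The description leaves the order of the other
  two corners open, hence the two cases at the end.\<close>

lemma inner_angle_eq:
  assumes u: "u \<in> neg_orthant"
  shows "inner_angle \<Phi> (radius_of u) {i, j, k} i = triangle_angle \<Phi> u i j k"
proof -
  interpret r: acute_triangle \<Phi> j k i by (rule rotate)
  interpret q: acute_triangle \<Phi> k i j by (rule rotate)
  define x y z where "x = cosh_length \<Phi> u j k" "y = cosh_length \<Phi> u i k" "z = cosh_length \<Phi> u i j"
  note xyz = this
  have gt: "1 < x" "1 < y" "1 < z"
    using cosh_length_gt_1[OF u] r.cosh_length_gt_1[OF u] q.cosh_length_gt_1[OF u]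
    by (auto simp: xyz cosh_length_commute[of \<Phi> u k i])
  have gr: "0 < gram x y z" using gram_lengths_pos[OF u] by (simp add: xyz)
  note sym = cosh_length_commute[of \<Phi> u j i] cosh_length_commute[of \<Phi> u k i]
    cosh_length_commute[of \<Phi> u k j]
  have len: "edge_length \<Phi> (radius_of u) i j = arcosh z" "edge_length \<Phi> (radius_of u) i k = arcosh y"
    "edge_length \<Phi> (radius_of u) j k = arcosh x" "edge_length \<Phi> (radius_of u) j i = arcosh z"
    "edge_length \<Phi> (radius_of u) k i = arcosh y" "edge_length \<Phi> (radius_of u) k j = arcosh x"
    by (simp_all add: edge_length_radius_of[OF u] sym xyz)
  show ?thesis
    unfolding inner_angle_def triangle_angle_def xyz[symmetric]
  proof (rule the_equality)
    obtain p s t where pst: "p \<in> hyp_plane" "s \<in> hyp_plane" "t \<in> hyp_plane"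
      "lorentz p s = - z" "lorentz p t = - y" "lorentz s t = - x"
      using hyp_triangle_exists[OF gt(2,3) gr] by blast
    define P where "P l = (if l = i then p else if l = j then s else t)" for l
    have P: "P i = p" "P j = s" "P k = t" using distinct by (auto simp: P_def)
    have d: "hyp_dist p s = arcosh z" "hyp_dist p t = arcosh y" "hyp_dist s t = arcosh x"
      "hyp_dist s p = arcosh z" "hyp_dist t p = arcosh y" "hyp_dist t s = arcosh x"
      using pst by (simp_all add: hyp_dist_def lorentz_commute[of s p] lorentz_commute[of t p]
          lorentz_commute[of t s])
    show "\<exists>P j' k'. {i, j, k} = {i, j', k'} \<and> (\<forall>l\<in>{i, j, k}. P l \<in> hyp_plane) \<and>
        (\<forall>l\<in>{i, j, k}. \<forall>m\<in>{i, j, k}. l \<noteq> m \<longrightarrow>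
           hyp_dist (P l) (P m) = edge_length \<Phi> (radius_of u) l m) \<and>
        opposite_angle x y z = hyp_angle (P j') (P i) (P k')"
      by (rule exI[of _ P], rule exI[of _ j], rule exI[of _ k])
        (use distinct pst d in \<open>auto simp: P len hyp_angle_eq\<close>)
  next
    fix \<theta>
    assume "\<exists>P j' k'. {i, j, k} = {i, j', k'} \<and> (\<forall>l\<in>{i, j, k}. P l \<in> hyp_plane) \<and>
        (\<forall>l\<in>{i, j, k}. \<forall>m\<in>{i, j, k}. l \<noteq> m \<longrightarrow>
           hyp_dist (P l) (P m) = edge_length \<Phi> (radius_of u) l m) \<and>
        \<theta> = hyp_angle (P j') (P i) (P k')"
    then obtain P j' k' where jk: "{i, j, k} = {i, j', k'}" and P: "\<forall>l\<in>{i, j, k}. P l \<in> hyp_plane"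
      and d: "\<forall>l\<in>{i, j, k}. \<forall>m\<in>{i, j, k}. l \<noteq> m \<longrightarrow>
           hyp_dist (P l) (P m) = edge_length \<Phi> (radius_of u) l m"
      and \<theta>: "\<theta> = hyp_angle (P j') (P i) (P k')"
      by blast
    from P have Pi: "P i \<in> hyp_plane" "P j \<in> hyp_plane" "P k \<in> hyp_plane" by auto
    have "hyp_dist (P i) (P j) = arcosh z" "hyp_dist (P i) (P k) = arcosh y"
      "hyp_dist (P j) (P k) = arcosh x"
      using d distinct len by auto
    then have l: "lorentz (P i) (P j) = - z" "lorentz (P i) (P k) = - y" "lorentz (P j) (P k) = - x"
      using hyp_dist_eq_arcosh_iff Pi gt by auto
    have "j \<in> {i, j', k'}" "k \<in> {i, j', k'}" using jk by blast+
    then have "j' = j \<and> k' = k \<or> j' = k \<and> k' = j"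
      using distinct by auto
    then show "\<theta> = opposite_angle x y z"
    proof (elim disjE conjE)
      assume "j' = k" "k' = j"
      then show ?thesis
        using hyp_angle_eq[of "P i" "P k" y "P j" z x] Pi l
        by (simp add: \<theta> lorentz_commute[of "P k"] opposite_angle_commute)
    qed (use hyp_angle_eq[of "P i" "P j" z "P k" y x] Pi l in \<open>simp add: \<theta>\<close>)
  qed
qed

end

section \<open>Every vertex lies in a face\<close>

text \<open>A maximal simplex with at most two vertices would have an open interior that a single barycentric
  coordinate embeds in the line, against invariance of dimension.\<close>

lemma maximal_simplex_card:
  fixes M :: "'m topology" and E F :: "'v::finite set set" and h :: "real^'v \<Rightarrow> 'm"
  assumes M: "closed_connected_surface M" and tri: "surface_triangulation M E F h"
    and s: "s \<in> simplices E F" "s \<noteq> {}"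
    and max: "\<And>t. t \<in> simplices E F \<Longrightarrow> s \<subseteq> t \<Longrightarrow> t = s"
  shows "2 < card s"
proof (rule ccontr)
  assume "\<not> 2 < card s"
  then have card2: "card s \<le> 2" by simp
  define R where "R = realization (simplices E F)"
  define W where "W = {x \<in> R. \<forall>i\<in>s. x $ i \<noteq> 0}"
  from s(2) obtain v where v: "v \<in> s" by blast
  \<comment> \<open>By maximality of s, the open set of points whose support contains s consists of
    points with support exactly s: it is the relative interior of s.\<close>
  have supp: "{i. x $ i \<noteq> 0} = s" if "x \<in> W" for x
  proof (rule max)
    show "{i. x $ i \<noteq> 0} \<in> simplices E F" "s \<subseteq> {i. x $ i \<noteq> 0}"
      using that by (auto simp: W_def R_def realization_def)
  qed
  \<comment> \<open>The coordinates over s sum to 1, and s has at most one vertex besides v.\<close>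
  have injW: "inj_on (\<lambda>x. x $ v) W"
  proof (rule inj_onI)
    fix x y assume xy: "x \<in> W" "y \<in> W" "x $ v = y $ v"
    have sums: "sum (($) z) s = 1" if "z \<in> W" for z
    proof -
      have "sum (($) z) s = sum (($) z) UNIV"
        using supp[OF that] by (intro sum.mono_neutral_left) auto
      then show ?thesis using that by (simp add: W_def R_def realization_def)
    qed
    have "card (s - {v}) \<le> Suc 0" using card2 v by simp
    then have w: "i = j" if "i \<in> s - {v}" "j \<in> s - {v}" for i j
      using that card_le_Suc0_iff_eq[of "s - {v}"] by auto
    have "x $ i = y $ i" if "i \<in> s" for i
    proof (cases "i = v")
      case False
      with that w v have "s = {v, i}" by blast
      then show ?thesis using sums[OF xy(1)] sums[OF xy(2)] xy(3) False by simp
    qed (use xy in simp)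
    moreover have "x $ i = 0" "y $ i = 0" if "i \<notin> s" for i
      using supp[OF xy(1)] supp[OF xy(2)] that by auto
    ultimately show "x = y" by (metis vec_eq_iff)
  qed
  have openW: "openin (top_of_set R) W"
  proof -
    have "open {x :: real^'v. \<forall>i\<in>s. x $ i \<noteq> 0}"
      unfolding Collect_ball_eq
      by (intro open_INT finite ballI open_Collect_neq continuous_intros)
    then show ?thesis
      unfolding openin_open W_def by (intro exI[of _ "{x. \<forall>i\<in>s. x $ i \<noteq> 0}"]) auto
  qed
  have "W \<noteq> {}"
  proof -
    define x :: "real^'v" where "x = (\<chi> i. if i \<in> s then 1 / card s else 0)"
    have c: "card s \<noteq> 0" using s(2) by simp
    have "sum (($) x) UNIV = sum (\<lambda>i. 1 / card s) s"
      by (simp add: x_def sum.If_cases)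
    then have "sum (($) x) UNIV = 1" using c by simp
    moreover have "{i. x $ i \<noteq> 0} = s" using c by (auto simp: x_def)
    ultimately have "x \<in> W" using s(1) c by (auto simp: W_def R_def realization_def x_def)
    then show ?thesis by blast
  qed
  then obtain p where p: "p \<in> W" by blast
  have WR: "W \<subseteq> R" by (auto simp: W_def)
  have hm: "homeomorphic_map (top_of_set R) M h"
    using tri by (simp add: surface_triangulation_def R_def)
  then obtain h' where h': "homeomorphic_maps (top_of_set R) M h h'"
    by (auto simp: homeomorphic_map_maps)
  have openhW: "openin M (h ` W)"
    using hm openW homeomorphic_imp_open_map open_map_def by blast
  with p have "h p \<in> topspace M" using openin_subset by blast
  then obtain U where U: "openin M U" "h p \<in> U"
    "subtopology M U homeomorphic_space (euclidean :: (real^2) topology)"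
    using M by (auto simp: closed_connected_surface_def)
  then obtain g g' where g: "homeomorphic_maps (subtopology M U) (euclidean :: (real^2) topology) g g'"
    by (auto simp: homeomorphic_space_def)
  \<comment> \<open>A nonempty open piece of the plane: the part of W seen in a chart. The
    coordinate at v would embed it in the line.\<close>
  define V where "V = g ` (U \<inter> h ` W)"
  have UM: "U \<subseteq> topspace M" using U(1) openin_subset by blast
  have gg: "g' (g x) = x" if "x \<in> U" for x
    using g that UM by (auto simp: homeomorphic_maps_def)
  have hh: "h' (h x) = x" if "x \<in> R" for x
    using h' that by (auto simp: homeomorphic_maps_def)
  have "openin (subtopology M U) (U \<inter> h ` W)"
    using openhW by (auto simp: openin_subtopology)
  moreover have "open_map (subtopology M U) euclidean g"
    by (rule homeomorphic_imp_open_map[OF homeomorphic_maps_imp_map[OF g]])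
  ultimately have "openin euclidean (g ` (U \<inter> h ` W))"
    unfolding open_map_def by blast
  then have "open V"
    by (simp only: V_def open_openin)
  have "V \<noteq> {}" using p U by (auto simp: V_def)
  have g'V: "g' x \<in> U \<inter> h ` W" if "x \<in> V" for x
    using that gg by (auto simp: V_def)
  have h'g'V: "h' (g' x) \<in> W" if "x \<in> V" for x
    using g'V[OF that] hh WR by auto
  define f where "f x = h' (g' x) $ v" for x
  have "continuous_map euclidean (subtopology M U) g'"
    using g by (simp add: homeomorphic_maps_def)
  then have "continuous_map (top_of_set V) M g'"
    by (simp add: continuous_map_from_subtopology continuous_map_in_subtopology)
  moreover have "continuous_map M (top_of_set R) h'"
    using h' by (simp add: homeomorphic_maps_def)
  ultimately have "continuous_map (top_of_set V) (top_of_set R) (h' \<circ> g')"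
    by (rule continuous_map_compose)
  then have "continuous_on V (h' \<circ> g')" by (simp add: continuous_map_in_subtopology)
  then have "continuous_on V f"
    unfolding f_def o_def by (intro continuous_intros)
  moreover have "inj_on f V"
  proof (rule inj_onI)
    fix x y assume xy: "x \<in> V" "y \<in> V" "f x = f y"
    then have "h' (g' x) = h' (g' y)"
      using injW h'g'V by (auto simp: f_def inj_on_def)
    then have "g' x = g' y"
      using g'V[OF xy(1)] g'V[OF xy(2)] hh WR by (metis IntE imageE subsetD)
    then show "x = y" using xy(1,2) gg by (auto simp: V_def)
  qed
  ultimately have "DIM(real^2) \<le> DIM(real)"
    using \<open>open V\<close> \<open>V \<noteq> {}\<close> by (intro invariance_of_dimension)
  then show False by simp
qed

text \<open>A maximal simplex containing v has more than two vertices, so it is neither a vertex nor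
  an edge.\<close>

lemma vertex_in_face:
  fixes M :: "'m topology" and E F :: "'v::finite set set" and h :: "real^'v \<Rightarrow> 'm"
  assumes "closed_connected_surface M" and tri: "surface_triangulation M E F h"
  obtains f where "f \<in> F" "v \<in> f"
proof -
  have "finite (simplices E F)" by (rule finite)
  moreover have "{v} \<in> simplices E F" by (auto simp: simplices_def)
  ultimately obtain s where s: "s \<in> simplices E F" "{v} \<subseteq> s"
    and "\<And>t. t \<in> simplices E F \<Longrightarrow> s \<subseteq> t \<Longrightarrow> t = s"
    using finite_has_maximal2[of "simplices E F" "{v}"] by metis
  then have "2 < card s"
    by (intro maximal_simplex_card[OF assms]) auto
  moreover have "card t = 1" if "t \<in> range (\<lambda>v. {v})" for t :: "'v set" using that by auto
  ultimately have "s \<in> F"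
    using s(1) tri by (auto simp: simplices_def surface_triangulation_def two_complex_def)
  with s(2) that show ?thesis by blast
qed

section \<open>The Jacobian of the potential form\<close>

definition softmax :: "real \<Rightarrow> real^'v::finite \<Rightarrow> real^'v" where
  "softmax \<alpha> u = (\<chi> i. exp (\<alpha> * u $ i) / (\<Sum>j\<in>UNIV. exp (\<alpha> * u $ j)))"

definition softmax_jacobian :: "real \<Rightarrow> real^'v::finite \<Rightarrow> real^'v \<Rightarrow> real^'v" where
  "softmax_jacobian \<alpha> u h = (\<chi> i. \<alpha> * softmax \<alpha> u $ i * (h $ i - softmax \<alpha> u \<bullet> h))"

lemma sum_exp_pos: "0 < (\<Sum>j\<in>(UNIV :: 'v::finite set). exp (\<alpha> * u $ j :: real))"
  by (intro sum_pos) auto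

lemma softmax_symmetric_jacobian: "symmetric_jacobian S (softmax \<alpha>) (softmax_jacobian \<alpha>)"
  unfolding symmetric_jacobian_def
proof (intro conjI ballI allI)
  fix u :: "real^'v"
  define Z where "Z u = (\<Sum>j\<in>UNIV. exp (\<alpha> * u $ j))" for u :: "real^'v"
  have Z: "0 < Z u" by (simp add: Z_def sum_exp_pos)
  have dexp: "((\<lambda>u. exp (\<alpha> * u $ i)) has_derivative (\<lambda>h. exp (\<alpha> * u $ i) * (\<alpha> * h $ i))) (at u)" for i
    by (auto intro!: derivative_eq_intros)
  have dZ: "(Z has_derivative (\<lambda>h. \<Sum>j\<in>UNIV. exp (\<alpha> * u $ j) * (\<alpha> * h $ j))) (at u)"
    unfolding Z_def by (intro has_derivative_sum dexp)
  have s: "(\<Sum>j\<in>UNIV. exp (\<alpha> * u $ j) * (\<alpha> * h $ j)) = \<alpha> * Z u * (softmax \<alpha> u \<bullet> h)" for h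
    using Z by (simp add: softmax_def inner_vec_def sum_distrib_left mult_ac flip: Z_def)
  have "((\<lambda>u. exp (\<alpha> * u $ i) / Z u) has_derivative
      (\<lambda>h. \<alpha> * softmax \<alpha> u $ i * (h $ i - softmax \<alpha> u \<bullet> h))) (at u)" for i
    by (rule has_derivative_eq_rhs[OF has_derivative_divide[OF dexp dZ]])
      (use Z in \<open>auto simp: fun_eq_iff s, simp add: softmax_def field_simps flip: Z_def\<close>)
  then show "(softmax \<alpha> has_derivative softmax_jacobian \<alpha> u) (at u)"
    unfolding has_derivative_componentwise_within[of "softmax \<alpha>"]
    by (auto simp: Basis_vec_def inner_axis softmax_jacobian_def)
      (simp add: softmax_def flip: Z_def)
  show "softmax_jacobian \<alpha> u v \<bullet> w = v \<bullet> softmax_jacobian \<alpha> u w" for v w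
  proof -
    have "softmax_jacobian \<alpha> u v \<bullet> w = \<alpha> * (\<Sum>i\<in>UNIV. softmax \<alpha> u $ i * v $ i * w $ i)
        - \<alpha> * ((softmax \<alpha> u \<bullet> v) * (softmax \<alpha> u \<bullet> w))" for v w
      unfolding inner_vec_def[of "softmax_jacobian \<alpha> u v"] inner_vec_def[of "softmax \<alpha> u" w]
      by (simp add: softmax_jacobian_def sum_distrib_left sum_subtractf algebra_simps)
    from this[of v w] this[of w v] show ?thesis
      by (simp add: inner_commute[of v] mult_ac)
  qed
next
  show "continuous_on S (\<lambda>u. softmax_jacobian \<alpha> u v)" for v
    unfolding softmax_jacobian_def softmax_def inner_vec_def
    using sum_exp_pos[of \<alpha>, THEN less_imp_neq, THEN not_sym] by (auto intro!: continuous_intros)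
qed

text \<open>The quadratic form is \<alpha> times the variance of the coordinates of v under the
  probability weights p; m is their mean, and the cross term vanishes by centring.\<close>

lemma softmax_jacobian_nonneg:
  assumes "0 \<le> \<alpha>" shows "0 \<le> softmax_jacobian \<alpha> u v \<bullet> v"
proof -
  define p where "p i = softmax \<alpha> u $ i" for i
  define m where "m = softmax \<alpha> u \<bullet> v"
  have m: "m = (\<Sum>i\<in>UNIV. p i * v $ i)" by (simp add: m_def p_def inner_vec_def)
  have p: "0 \<le> p i" for i
    using sum_exp_pos[of \<alpha> u] by (simp add: p_def softmax_def)
  have "(\<Sum>i\<in>UNIV. p i) = 1"
    using sum_exp_pos[of \<alpha> u] by (simp add: p_def softmax_def flip: sum_divide_distrib)
  moreover have "(\<Sum>i\<in>UNIV. p i * (v $ i - m) * m) = (\<Sum>i\<in>UNIV. p i * v $ i) * m - (\<Sum>i\<in>UNIV. p i) * m * m"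
    unfolding sum_distrib_right sum_subtractf[symmetric] by (simp add: algebra_simps)
  ultimately have "(\<Sum>i\<in>UNIV. p i * (v $ i - m) * m) = 0"
    by (simp flip: m)
  moreover have "softmax_jacobian \<alpha> u v \<bullet> v = (\<Sum>i\<in>UNIV. \<alpha> * (p i * (v $ i - m)\<^sup>2))
      + \<alpha> * (\<Sum>i\<in>UNIV. p i * (v $ i - m) * m)"
    unfolding inner_vec_def[of "softmax_jacobian \<alpha> u v"] sum_distrib_left sum.distrib[symmetric]
    by (intro sum.cong) (simp_all add: softmax_jacobian_def p_def m_def power2_eq_square algebra_simps)
  ultimately show ?thesis
    using assms p by (simp add: sum_nonneg)
qed

lemma open_neg_orthant: "open (neg_orthant :: (real^'v::finite) set)"
  unfolding neg_orthant_def Collect_all_eq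
  by (intro open_INT finite ballI open_Collect_less continuous_intros) 

lemma convex_neg_orthant: "convex (neg_orthant :: (real^'v) set)"
proof (rule convexI)
  fix x y :: "real^'v" and s t :: real
  assume "x \<in> neg_orthant" "y \<in> neg_orthant" "0 \<le> s" "0 \<le> t" "s + t = 1"
  then have "s * x $ i + t * y $ i < 0" for i
    using convex_bound_lt[of "x $ i" 0 "y $ i" s t] by (simp add: neg_orthant_def)
  then show "s *\<^sub>R x + t *\<^sub>R y \<in> neg_orthant" by (simp add: neg_orthant_def)
qed

section \<open>Assembling the faces\<close>

definition face_field :: "('v set \<Rightarrow> real) \<Rightarrow> 'v set \<Rightarrow> real^'v \<Rightarrow> real^'v" where
  "face_field \<Phi> f u = (\<chi> l. if l \<in> f then inner_angle \<Phi> (radius_of u) f l else 0)"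

text \<open>A face is an unordered set, so its Jacobian is only asserted to exist and an ordering is
  chosen inside. All rotations share one Jacobian, so a nonzero coordinate at any corner gives
  strictness.\<close>

lemma face_field_negative_jacobian:
  fixes E F :: "'v::finite set set"
  assumes tc: "two_complex E F" and ew: "edge_weight E \<Phi>" and f: "f \<in> F"
  shows "\<exists>W. symmetric_jacobian neg_orthant (face_field \<Phi> f) W \<and>
    (\<forall>u\<in>neg_orthant. \<forall>v. W u v \<bullet> v \<le> 0 \<and> ((\<exists>l\<in>f. v $ l \<noteq> 0) \<longrightarrow> W u v \<bullet> v < 0))"
proof -
  from tc f have "card f = 3" by (simp add: two_complex_def)
  then obtain i j k where ijk: "f = {i, j, k}" "i \<noteq> j" "i \<noteq> k" "j \<noteq> k"
    by (auto simp: card_3_iff)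
  have cos: "cos (\<Phi> {a, b}) \<in> {0..1}" if "a \<in> f" "b \<in> f" "a \<noteq> b" for a b
  proof -
    have "{a, b} \<in> E" using tc f that by (simp add: two_complex_def)
    then have "0 \<le> \<Phi> {a, b}" "\<Phi> {a, b} \<le> pi / 2" using ew by (auto simp: edge_weight_def)
    then show ?thesis by (auto intro!: cos_ge_zero)
  qed
  interpret acute_triangle \<Phi> i j k
    using ijk cos by unfold_locales auto
  interpret r: acute_triangle \<Phi> j k i by (rule rotate)
  interpret q: acute_triangle \<Phi> k i j by (rule rotate)
  have eq: "angle_field \<Phi> i j k u = face_field \<Phi> f u" if "u \<in> neg_orthant" for u
  proof -
    have perm: "{j, k, i} = f" "{k, i, j} = f" "{i, j, k} = f" using ijk by auto
    have "inner_angle \<Phi> (radius_of u) f i = triangle_angle \<Phi> u i j k"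
      "inner_angle \<Phi> (radius_of u) f j = triangle_angle \<Phi> u j k i"
      "inner_angle \<Phi> (radius_of u) f k = triangle_angle \<Phi> u k i j"
      using inner_angle_eq[OF that] r.inner_angle_eq[OF that] q.inner_angle_eq[OF that]
      unfolding perm by auto
    then show ?thesis
      using ijk by (auto simp: vec_eq_iff angle_field_def face_field_def axis_def)
  qed
  have cyc: "angle_jacobian \<Phi> j k i = angle_jacobian \<Phi> i j k" "angle_jacobian \<Phi> k i j = angle_jacobian \<Phi> i j k"
    by (simp_all add: fun_eq_iff angle_jacobian_def add_ac)
  show ?thesis
  proof (intro exI conjI ballI allI impI)
    show "symmetric_jacobian neg_orthant (face_field \<Phi> f) (angle_jacobian \<Phi> i j k)"
      by (rule symmetric_jacobian_cong[OF angle_field_symmetric_jacobian open_neg_orthant eq])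
    fix u v :: "real^'v" assume u: "u \<in> neg_orthant"
    show "angle_jacobian \<Phi> i j k u v \<bullet> v \<le> 0" by (rule angle_jacobian_negative(1)[OF u])
    show "angle_jacobian \<Phi> i j k u v \<bullet> v < 0" if "\<exists>l\<in>f. v $ l \<noteq> 0"
      using that angle_jacobian_negative(2)[OF u] r.angle_jacobian_negative(2)[OF u]
        q.angle_jacobian_negative(2)[OF u]
      unfolding cyc ijk(1) by blast
  qed
qed

text \<open>Because tanh (r_i / 2) = exp u_i, the quotient in the term with \<open>s_alpha\<close>
  is a softmax. The face fields vanish off their faces, so their plain sum gives the angle
  sums.\<close>

lemma potential_form_eq:
  fixes E F :: "'v::finite set set"
  assumes "u \<in> neg_orthant"
  shows "potential_form E F \<Phi> \<beta> \<alpha> u = (\<chi> i. 2 * pi + 2 * pi * real (\<beta> i))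
    + (- 1) *\<^sub>R (\<Sum>f\<in>F. face_field \<Phi> f u) + (- (2 * pi * euler_char E F)) *\<^sub>R softmax \<alpha> u"
proof -
  have t: "tanh (radius_of u i / 2) powr \<alpha> = exp (\<alpha> * u $ i)" for i
    by (simp add: tanh_radius_of[OF assms] powr_def)
  have "(\<Sum>f | f \<in> F \<and> i \<in> f. inner_angle \<Phi> (radius_of u) f i) = (\<Sum>f\<in>F. face_field \<Phi> f u) $ i" for i
    by (simp add: face_field_def sum.If_cases Int_def)
  then show ?thesis
    by (simp add: vec_eq_iff potential_form_def Let_def curvature_def s_alpha_def softmax_def t)
qed

lemma potential_form_positive_jacobian:
  fixes M :: "'m topology" and E F :: "'v::finite set set" and h :: "real^'v \<Rightarrow> 'm"
  assumes M: "closed_connected_surface M" and tri: "surface_triangulation M E F h"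
    and ew: "edge_weight E \<Phi>" and \<chi>: "euler_char E F \<le> 0" and \<alpha>: "0 \<le> \<alpha>"
  obtains W where "symmetric_jacobian neg_orthant (potential_form E F \<Phi> \<beta> \<alpha>) W"
    and "\<And>u v. u \<in> neg_orthant \<Longrightarrow> v \<noteq> 0 \<Longrightarrow> 0 < W u v \<bullet> v"
proof -
  have "two_complex E F" using tri by (simp add: surface_triangulation_def)
  then have "\<forall>f\<in>F. \<exists>W. symmetric_jacobian neg_orthant (face_field \<Phi> f) W \<and>
    (\<forall>u\<in>neg_orthant. \<forall>v. W u v \<bullet> v \<le> 0 \<and> ((\<exists>l\<in>f. v $ l \<noteq> 0) \<longrightarrow> W u v \<bullet> v < 0))"
    using face_field_negative_jacobian[OF _ ew] by blast
  from bchoice[OF this] obtain V where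
    V: "\<forall>f\<in>F. symmetric_jacobian neg_orthant (face_field \<Phi> f) (V f) \<and>
      (\<forall>u\<in>neg_orthant. \<forall>v. V f u v \<bullet> v \<le> 0 \<and> ((\<exists>l\<in>f. v $ l \<noteq> 0) \<longrightarrow> V f u v \<bullet> v < 0))" ..
  define c where "c = - (2 * pi * euler_char E F)"
  \<comment> \<open>The sign of the Euler characteristic enters here: it makes the softmax term
    contribute nonnegatively.\<close>
  have c: "0 \<le> c" using \<chi> by (simp add: c_def mult_le_0_iff)
  define W where "W u v = 0 + (- 1) *\<^sub>R (\<Sum>f\<in>F. V f u v) + c *\<^sub>R softmax_jacobian \<alpha> u v" for u v
  have "symmetric_jacobian neg_orthant (\<lambda>u. \<Sum>f\<in>F. face_field \<Phi> f u) (\<lambda>u v. \<Sum>f\<in>F. V f u v)"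
    using V by (intro symmetric_jacobian_sum) blast
  from symmetric_jacobian_add[OF
      symmetric_jacobian_add[OF symmetric_jacobian_const symmetric_jacobian_scaleR[OF this]]
      symmetric_jacobian_scaleR[OF softmax_symmetric_jacobian],
      of "\<chi> i. 2 * pi + 2 * pi * real (\<beta> i)" "- 1" c \<alpha>]
  have "symmetric_jacobian neg_orthant (potential_form E F \<Phi> \<beta> \<alpha>) W"
    unfolding W_def [abs_def] c_def
    by (rule symmetric_jacobian_cong[OF _ open_neg_orthant potential_form_eq[symmetric]])
  moreover have "0 < W u v \<bullet> v" if u: "u \<in> neg_orthant" and "v \<noteq> 0" for u v
  proof -
    from \<open>v \<noteq> 0\<close> obtain l where "v $ l \<noteq> 0" by (auto simp: vec_eq_iff)
    moreover obtain f where "f \<in> F" "l \<in> f" using vertex_in_face[OF M tri] .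
    \<comment> \<open>One face at a vertex where v is nonzero suffices, as every other face
      contributes with the same weak sign.\<close>
    ultimately have "\<exists>f\<in>F. V f u v \<bullet> v < 0" using V u by blast
    then have "(\<Sum>f\<in>F. V f u v \<bullet> v) < (\<Sum>f\<in>F. 0)"
      using V u by (intro sum_strict_mono_ex1) auto
    moreover have "0 \<le> c * (softmax_jacobian \<alpha> u v \<bullet> v)"
      by (rule mult_nonneg_nonneg[OF c softmax_jacobian_nonneg[OF \<alpha>]])
    ultimately show ?thesis
      by (simp add: W_def inner_diff_left inner_add_left inner_sum_left)
  qed
  ultimately show ?thesis using that by blast
qed

theorem theorem4p2:
  fixes M :: "'m topology"
    and E F :: "'v::finite set set"
    and h :: "real^'v \<Rightarrow> 'm"
    and \<Phi> :: "'v set \<Rightarrow> real"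
    and \<beta> :: "'v \<Rightarrow> nat"
    and \<alpha> :: real
    and ustar :: "real^'v"
  assumes "closed_connected_surface M"
    and "surface_triangulation M E F h"
    and "edge_weight E \<Phi>"
    and "euler_char E F \<le> -1"
    and "branch_structure M E h \<Phi> \<beta>"
    and "0 \<le> \<alpha>"
    and "ustar \<in> neg_orthant"
  shows "strictly_convex_on neg_orthant (branched_potential E F \<Phi> \<beta> \<alpha> ustar)"
proof -
  let ?\<omega> = "potential_form E F \<Phi> \<beta> \<alpha>"
  obtain W where W: "symmetric_jacobian neg_orthant ?\<omega> W"
    and pos: "\<And>u v. u \<in> neg_orthant \<Longrightarrow> v \<noteq> 0 \<Longrightarrow> 0 < W u v \<bullet> v"
    using potential_form_positive_jacobian[OF assms(1-3) _ assms(6)] assms(4) by auto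
  obtain G where G: "\<And>u. u \<in> neg_orthant \<Longrightarrow> (G has_derivative (\<lambda>h. ?\<omega> u \<bullet> h)) (at u)"
    using symmetric_jacobian_potential[OF convex_neg_orthant open_neg_orthant W] by blast
  have "strictly_convex_on neg_orthant G"
    using strictly_convex_on_positive_jacobian[where W = W, OF convex_neg_orthant G _ pos] W
    by (auto simp: symmetric_jacobian_def)
  \<comment> \<open>The potential is G up to the constant \<open>G ustar\<close>, which cancels in
    the convexity inequality since the weights add up to 1.\<close>
  moreover have "branched_potential E F \<Phi> \<beta> \<alpha> ustar u = G u - G ustar" if "u \<in> neg_orthant" for u
    unfolding branched_potential_def
    by (rule path_independent_integral_eq[OF convex_neg_orthant assms(7) that G])
  moreover have "(1 - t) *\<^sub>R x + t *\<^sub>R y \<in> neg_orthant"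
    if "x \<in> neg_orthant" "y \<in> neg_orthant" "0 < t" "t < 1" for x y :: "real^'v" and t
    using convexD_alt[OF convex_neg_orthant that(1,2)] that by simp
  ultimately show ?thesis
    by (simp add: strictly_convex_on_def) (simp add: algebra_simps)
qed

end
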